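(* Let $\mathcal{F} = \{f_i\}_{i \in I}$ and $\mathcal{E} = \{e_j\}_{j \in G}$ be frames for $H$, and let $a \colon I \to G$ be an associated map such that $D^+(I,a) < \infty$. If $(\mathcal{F}, a, \mathcal{E})$ has both $\ell^2$-column decay and $\ell^2$-row decay, then the following statements hold. (a) For each free ultrafilter $p$ and sequence of centers $c = (c_N)_{N \in \mathbf{N}}$ in $G$, we have $\mathcal{M}(\mathcal{E};p,c) = D(p,c) \cdot \mathcal{M}(\mathcal{F};p,c)$. Consequently, $$\mathcal{M}^-(\mathcal{E}) \le D^+(I,a) \cdot \mathcal{M}^-(\mathcal{F}) \le \mathcal{M}^+(\mathcal{E}), \qquad \mathcal{M}^-(\mathcal{E}) \le D^-(I,a) \cdot \mathcal{M}^+(\mathcal{F}) \le \mathcal{M}^+(\mathcal{E}).$$ (b) If $D^+(I,a) > \mathcal{M}^+(\mathcal{E})$, then there exists an infinite set $J \subset I$ such that $\{f_i\}_{i \in I \setminus J}$ is still a frame for $H$. If $\mathcal{E}$ is a Riesz basis for $H$, then the following additional statements hold. (c) For each free ultrafilter $p$ and sequence of centers $c = (c_N)_{N \in \mathbf{N}}$ in $G$, we have $$\mathcal{M}(\mathcal{F};p,c) = \frac1{D(p,c)}, \quad \mathcal{M}^-(\mathcal{F}) = \frac1{D^+(I,a)}, \quad \mathcal{M}^+(\mathcal{F}) = \frac1{D^-(I,a)}.$$ (d) $D^-(I,a) \ge 1$. (e) If $D^+(I,a) > 1$, then there exists an infinite subset $J \subset I$ such that $\{f_i\}_{i \in I \setminus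 J}$ is still a frame for $H$. (f) If $\mathcal{F}$ is also a Riesz basis for $H$, then for each free ultrafilter $p$ and sequence of centers $c = (c_N)_{N \in \mathbf{N}}$ in $G$, we have $$D^-(I,a) = D(p,c) = D^+(I,a) = 1, \qquad \mathcal{M}^-(\mathcal{F}) = \mathcal{M}(\mathcal{F};p,c) = \mathcal{M}^+(\mathcal{F}) = 1.$$
   Context: $H$ is a separable Hilbert space and $I$ is a countable index set. $G$ is a countably infinite abelian group of the form $G = \prod_{i=1}^d a_i \mathbf{Z} \times \prod_{j=1}^e \mathbf{Z}_{n_j}$, equipped with the metric $d(g,h)=|g-h|$, where $|g| = \sup\{|a_1 k_1|,\dots,|a_d k_d|,\delta(m_1),\dots,\delta(m_e)\}$ for $g=(a_1k_1,\dots,a_dk_d,m_1,\dots,m_e)$, with $\delta(0)=0$ and $\delta(m)=1$ for $m\neq 0$. For each integer $N>0$ and $j\in G$ put $S_N(j) = \{k \in G : |k-j| \le N/2\}$ and $I_N(j) = a^{-1}(S_N(j))$; $|E|$ denotes the cardinality of a finite set $E$. A sequence $\{f_i\}_{i\in I}$ in $H$ is a frame for $H$ if there are constants $A,B>0$ with $A\|f\|^2\le\sum_{i\in I}|\langle f,f_i\rangle|^2\le B\|f\|^2$ for all $f\in H$. A Riesz basis for $H$ is the image of an orthonormal basis for $H$ under a continuous, invertible linear mapping. $\{\tilde f_i\}$, $\{\tilde e_j\}$ denote the canonical dual frames of $\mathcal{F}$, $\mathcal{E}$: $\tilde f_i = S^{-1}f_i$ with $S$ the frame operator $Sf=\sum_{i\in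 I}\langle f,f_i\rangle f_i$ of $\mathcal{F}$, and similarly for $\mathcal{E}$. Densities: $D^-(I,a) = \liminf_{N\to\infty} \inf_{j\in G} |I_N(j)|/|S_N(j)|$, $D^+(I,a) = \limsup_{N\to\infty} \sup_{j\in G} |I_N(j)|/|S_N(j)|$, and $D(p,c) = p\text{-}\lim_{N\in\mathbf{N}} |I_N(c_N)|/|S_N(c_N)|$, where $p\text{-}\lim$ is the limit along the free ultrafilter $p$ on $\mathbf{N}$. $(\mathcal{F},a,\mathcal{E})$ has $\ell^2$-column decay if for every $\varepsilon>0$ there is an integer $N_\varepsilon>0$ such that for all $j\in G$, $\sum_{i\in I\setminus I_{N_\varepsilon}(j)} |\langle f_i,e_j\rangle|^2<\varepsilon$. It has $\ell^2$-row decay if for every $\varepsilon>0$ there is an integer $N_\varepsilon>0$ such that for all $i\in I$, $\sum_{j\in G\setminus S_{N_\varepsilon}(a(i))} |\langle f_i,e_j\rangle|^2<\varepsilon$. Measures: $\mathcal{M}(\mathcal{F};p,c) = p\text{-}\lim_{N\in\mathbf{N}} \frac1{|I_N(c_N)|}\sum_{i\in I_N(c_N)} \langle f_i,\tilde f_i\rangle$, $\mathcal{M}^-(\mathcal{F}) = \liminf_{N\to\infty}\inf_{j\in G}\frac1{|I_N(j)|}\sum_{i\in I_N(j)}\langle f_i,\tilde f_i\rangle$, $\mathcal{M}^+(\mathcal{F}) = \limsup_{N\to\infty}\sup_{j\in G}\frac1{|I_N(j)|}\sum_{i\in I_N(j)}\langle f_i,\tilde f_i\rangle$; $\mathcal{M}(\mathcal{E};p,c)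 = p\text{-}\lim_{N\in\mathbf{N}} \frac1{|S_N(c_N)|}\sum_{k\in S_N(c_N)} \langle \tilde e_k,e_k\rangle$, $\mathcal{M}^-(\mathcal{E}) = \liminf_{N\to\infty}\inf_{j\in G}\frac1{|S_N(j)|}\sum_{k\in S_N(j)}\langle \tilde e_k,e_k\rangle$, $\mathcal{M}^+(\mathcal{E}) = \limsup_{N\to\infty}\sup_{j\in G}\frac1{|S_N(j)|}\sum_{k\in S_N(j)}\langle \tilde e_k,e_k\rangle$. *)

theory Defs
  imports "HOL-Analysis.Analysis" "HOL-Algebra.Product_Groups"
begin

section \<open>Hilbert spaces over the reals or the complex numbers\<close>

text \<open>
  The scalar field is the real or the complex field: up to isomorphism these are the only two
  instances of the following class. \<open>re_part\<close> is the real part.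
\<close>

class real_or_complex = real_normed_field +
  fixes conjug :: "'a \<Rightarrow> 'a"
    and re_part :: "'a \<Rightarrow> real"
  assumes conjug_add: "conjug (x + y) = conjug x + conjug y"
    and conjug_mult: "conjug (x * y) = conjug x * conjug y"
    and conjug_conjug: "conjug (conjug x) = x"
    and add_conjug: "x + conjug x = (2 * re_part x) *\<^sub>R 1"
    and mult_conjug: "x * conjug x = ((norm x)\<^sup>2) *\<^sub>R 1"

instantiation real :: real_or_complex
begin
definition conjug_real :: "real \<Rightarrow> real" where "conjug_real x = x"
definition re_part_real :: "real \<Rightarrow> real" where "re_part_real x = x"
instance
  by standard (simp_all add: conjug_real_def re_part_real_def power2_eq_square)
end

instantiation complex :: real_or_complex
begin
definition conjug_complex :: "complex \<Rightarrow> complex" where "conjug_complex z = cnj z"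
definition re_part_complex :: "complex \<Rightarrow> real" where "re_part_complex z = Re z"
instance
proof
  fix x y :: complex
  show "x * conjug x = ((norm x)\<^sup>2) *\<^sub>R 1"
    unfolding conjug_complex_def scaleR_conv_of_real by (simp only: complex_norm_square mult_1_right)
  show "x + conjug x = (2 * re_part x) *\<^sub>R 1"
    unfolding conjug_complex_def re_part_complex_def scaleR_conv_of_real
    by (simp only: complex_add_cnj mult_1_right)
qed (simp_all add: conjug_complex_def)
end

text \<open>
  A Hilbert space over \<open>'k\<close>: the space is the whole type \<open>'h\<close>, whose metric is complete
  by the class \<open>banach\<close>; the inner product \<open>ip\<close> is linear in its first argument.
\<close>

locale hilbert_space = vector_space smul
  for smul :: "'k::real_or_complex \<Rightarrow> 'h::banach \<Rightarrow> 'h" +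
  fixes ip :: "'h \<Rightarrow> 'h \<Rightarrow> 'k"
  assumes smul_of_real: "smul (of_real r) x = r *\<^sub>R x"
    and ip_add_left: "ip (x + y) z = ip x z + ip y z"
    and ip_smul_left: "ip (smul c x) y = c * ip x y"
    and ip_commute: "ip y x = conjug (ip x y)"
    and ip_self: "ip x x = of_real ((norm x)\<^sup>2)"

lemma hilbert_space_real_inner:
  "hilbert_space (scaleR :: real \<Rightarrow> 'a::{real_inner, banach} \<Rightarrow> 'a) inner"
  by unfold_locales
    (simp_all add: algebra_simps conjug_real_def inner_commute power2_norm_eq_inner)

lemma hilbert_space_complex: "hilbert_space (*) (\<lambda>x y. x * cnj y)"
proof unfold_locales
  show "x * cnj x = complex_of_real ((norm x)\<^sup>2)" for x
    by (simp only: complex_norm_square)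
qed (simp_all add: algebra_simps conjug_complex_def scaleR_conv_of_real)


section \<open>Frames and Riesz bases\<close>

definition is_frame :: "('h::real_normed_vector \<Rightarrow> 'h \<Rightarrow> 'k::real_normed_field) \<Rightarrow> 'i set \<Rightarrow> ('i \<Rightarrow> 'h) \<Rightarrow> bool" where
  "is_frame ip I f \<longleftrightarrow> (\<exists>A>0. \<exists>B>0. \<forall>h.
     (\<lambda>i. (norm (ip h (f i)))\<^sup>2) summable_on I \<and>
     A * (norm h)\<^sup>2 \<le> (\<Sum>\<^sub>\<infinity>i\<in>I. (norm (ip h (f i)))\<^sup>2) \<and>
     (\<Sum>\<^sub>\<infinity>i\<in>I. (norm (ip h (f i)))\<^sup>2) \<le> B * (norm h)\<^sup>2)"

definition frame_operator ::
  "('k::real_normed_field \<Rightarrow> 'h::real_normed_vector \<Rightarrow> 'h) \<Rightarrow> ('h \<Rightarrow> 'h \<Rightarrow> 'k) \<Rightarrow>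
   'i set \<Rightarrow> ('i \<Rightarrow> 'h) \<Rightarrow> 'h \<Rightarrow> 'h" where
  "frame_operator smul ip I f h = (\<Sum>\<^sub>\<infinity>i\<in>I. smul (ip h (f i)) (f i))"

definition dual_frame ::
  "('k::real_normed_field \<Rightarrow> 'h::real_normed_vector \<Rightarrow> 'h) \<Rightarrow> ('h \<Rightarrow> 'h \<Rightarrow> 'k) \<Rightarrow>
   'i set \<Rightarrow> ('i \<Rightarrow> 'h) \<Rightarrow> 'i \<Rightarrow> 'h" where
  "dual_frame smul ip I f i = inv_into UNIV (frame_operator smul ip I f) (f i)"

definition orthonormal_basis ::
  "('k::real_normed_field \<Rightarrow> 'h::real_normed_vector \<Rightarrow> 'h) \<Rightarrow> ('h \<Rightarrow> 'h \<Rightarrow> 'k) \<Rightarrow>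
   'i set \<Rightarrow> ('i \<Rightarrow> 'h) \<Rightarrow> bool" where
  "orthonormal_basis smul ip I b \<longleftrightarrow>
     (\<forall>i\<in>I. \<forall>j\<in>I. ip (b i) (b j) = (if i = j then 1 else 0)) \<and>
     closure (module.span smul (b ` I)) = UNIV"

definition riesz_basis ::
  "('k::real_normed_field \<Rightarrow> 'h::real_normed_vector \<Rightarrow> 'h) \<Rightarrow> ('h \<Rightarrow> 'h \<Rightarrow> 'k) \<Rightarrow>
   'i set \<Rightarrow> ('i \<Rightarrow> 'h) \<Rightarrow> bool" where
  "riesz_basis smul ip I f \<longleftrightarrow>
     (\<exists>b T. orthonormal_basis smul ip I b \<and>
        Vector_Spaces.linear smul smul T \<and> continuous_on UNIV T \<and> bij T \<and>
        (\<forall>i\<in>I. f i = T (b i)))"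


section \<open>The reference group\<close>

definition scaled_integers :: "real \<Rightarrow> real monoid" where
  "scaled_integers \<alpha> =
     \<lparr>carrier = range (\<lambda>k::int. \<alpha> * of_int k), monoid.mult = (+), one = 0\<rparr>"

type_synonym refelem = "(nat \<Rightarrow> real) \<times> (nat \<Rightarrow> int)"

text \<open>
  The lists \<open>\<alpha>s\<close> and \<open>ns\<close> hold the parameters \<open>a\<^sub>1, \<dots>, a\<^sub>d\<close> and \<open>n\<^sub>1, \<dots>, n\<^sub>e\<close>,
  indexed from 0. The library's \<open>integer_mod_group 0\<close> is the infinite cyclic group, so
  the intended finite factors require all entries of \<open>ns\<close> to be positive.
\<close>

definition refgroup :: "real list \<Rightarrow> nat list \<Rightarrow> refelem monoid" where
  "refgroup \<alpha>s ns =
     product_group {..<length \<alpha>s} (\<lambda>i. scaled_integers (\<alpha>s ! i)) \<times>\<times>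
     product_group {..<length ns} (\<lambda>j. integer_mod_group (ns ! j))"

lemma group_scaled_integers: "group (scaled_integers \<alpha>)"
proof (rule groupI)
  fix x y assume "x \<in> carrier (scaled_integers \<alpha>)" "y \<in> carrier (scaled_integers \<alpha>)"
  then obtain k l :: int where kl: "x = \<alpha> * of_int k" "y = \<alpha> * of_int l"
    by (auto simp: scaled_integers_def)
  have "x + y = \<alpha> * of_int (k + l)" "- x = \<alpha> * of_int (- k)"
    using kl by (simp_all add: algebra_simps)
  then have "x + y \<in> carrier (scaled_integers \<alpha>)" "- x \<in> carrier (scaled_integers \<alpha>)"
    unfolding scaled_integers_def monoid.simps partial_object.simps by blast+
  moreover have "x \<otimes>\<^bsub>scaled_integers \<alpha>\<^esub> y = x + y"
    "- x \<otimes>\<^bsub>scaled_integers \<alpha>\<^esub> x = \<one>\<^bsub>scaled_integers \<alpha>\<^esub>"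
    by (simp_all add: scaled_integers_def)
  ultimately show "x \<otimes>\<^bsub>scaled_integers \<alpha>\<^esub> y \<in> carrier (scaled_integers \<alpha>)"
    and "\<exists>z\<in>carrier (scaled_integers \<alpha>). z \<otimes>\<^bsub>scaled_integers \<alpha>\<^esub> x = \<one>\<^bsub>scaled_integers \<alpha>\<^esub>"
    by metis+
qed (auto simp: scaled_integers_def intro: image_eqI[of _ _ 0])

lemma group_refgroup: "group (refgroup \<alpha>s ns)"
  unfolding refgroup_def
  by (intro DirProd_group) (simp_all add: group_scaled_integers)

definition refnorm :: "real list \<Rightarrow> nat list \<Rightarrow> refelem \<Rightarrow> real" where
  "refnorm \<alpha>s ns g =
     Sup ((\<lambda>i. \<bar>fst g i\<bar>) ` {..<length \<alpha>s} \<union>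
          (\<lambda>j. if snd g j = 0 then 0 else 1) ` {..<length ns})"

definition refdist :: "real list \<Rightarrow> nat list \<Rightarrow> refelem \<Rightarrow> refelem \<Rightarrow> real" where
  "refdist \<alpha>s ns g h = refnorm \<alpha>s ns (g \<otimes>\<^bsub>refgroup \<alpha>s ns\<^esub> inv\<^bsub>refgroup \<alpha>s ns\<^esub> h)"

definition S_box :: "real list \<Rightarrow> nat list \<Rightarrow> nat \<Rightarrow> refelem \<Rightarrow> refelem set" where
  "S_box \<alpha>s ns N j = {k \<in> carrier (refgroup \<alpha>s ns). refdist \<alpha>s ns k j \<le> real N / 2}"

definition I_box ::
  "real list \<Rightarrow> nat list \<Rightarrow> 'i set \<Rightarrow> ('i \<Rightarrow> refelem) \<Rightarrow> nat \<Rightarrow> refelem \<Rightarrow> 'i set" where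
  "I_box \<alpha>s ns I a N j = {i \<in> I. a i \<in> S_box \<alpha>s ns N j}"


section \<open>Limits along ultrafilters and densities\<close>

definition free_ultrafilter :: "nat filter \<Rightarrow> bool" where
  "free_ultrafilter p \<longleftrightarrow>
     p \<noteq> bot \<and> (\<forall>P. eventually P p \<or> eventually (\<lambda>n. \<not> P n) p) \<and>
     (\<forall>m. eventually (\<lambda>n. n \<noteq> m) p)"

text \<open>
  Densities take values in the extended reals, and \<open>card\<close> is only used on finite sets, so that
  a set \<open>I\<^sub>N(j)\<close> which is infinite contributes \<open>\<infinity>\<close> and not \<open>0\<close>.
\<close>

definition ecount :: "'a set \<Rightarrow> ereal" where
  "ecount A = (if finite A then ereal (real (card A)) else \<infinity>)"

definition box_ratio ::
  "real list \<Rightarrow> nat list \<Rightarrow> 'i set \<Rightarrow> ('i \<Rightarrow> refelem) \<Rightarrow> nat \<Rightarrow> refelem \<Rightarrow> ereal" where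
  "box_ratio \<alpha>s ns I a N j = ecount (I_box \<alpha>s ns I a N j) / ecount (S_box \<alpha>s ns N j)"

definition lower_density ::
  "real list \<Rightarrow> nat list \<Rightarrow> 'i set \<Rightarrow> ('i \<Rightarrow> refelem) \<Rightarrow> ereal" where
  "lower_density \<alpha>s ns I a =
     liminf (\<lambda>N. INF j\<in>carrier (refgroup \<alpha>s ns). box_ratio \<alpha>s ns I a N j)"

definition upper_density ::
  "real list \<Rightarrow> nat list \<Rightarrow> 'i set \<Rightarrow> ('i \<Rightarrow> refelem) \<Rightarrow> ereal" where
  "upper_density \<alpha>s ns I a =
     limsup (\<lambda>N. SUP j\<in>carrier (refgroup \<alpha>s ns). box_ratio \<alpha>s ns I a N j)"

definition density_along ::
  "real list \<Rightarrow> nat list \<Rightarrow> 'i set \<Rightarrow> ('i \<Rightarrow> refelem) \<Rightarrow> nat filter \<Rightarrow> (nat \<Rightarrow> refelem) \<Rightarrow> ereal"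
  where
  "density_along \<alpha>s ns I a p c = Lim p (\<lambda>N. box_ratio \<alpha>s ns I a N (c N))"


section \<open>Column and row decay\<close>

definition l2_column_decay ::
  "('h \<Rightarrow> 'h \<Rightarrow> 'k::real_normed_field) \<Rightarrow> real list \<Rightarrow> nat list \<Rightarrow>
   'i set \<Rightarrow> ('i \<Rightarrow> 'h) \<Rightarrow> ('i \<Rightarrow> refelem) \<Rightarrow> (refelem \<Rightarrow> 'h) \<Rightarrow> bool" where
  "l2_column_decay ip \<alpha>s ns I f a e \<longleftrightarrow>
     (\<forall>\<epsilon>>0. \<exists>N>0. \<forall>j\<in>carrier (refgroup \<alpha>s ns).
        (\<lambda>i. (norm (ip (f i) (e j)))\<^sup>2) summable_on (I - I_box \<alpha>s ns I a N j) \<and>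
        (\<Sum>\<^sub>\<infinity>i\<in>I - I_box \<alpha>s ns I a N j. (norm (ip (f i) (e j)))\<^sup>2) < \<epsilon>)"

definition l2_row_decay ::
  "('h \<Rightarrow> 'h \<Rightarrow> 'k::real_normed_field) \<Rightarrow> real list \<Rightarrow> nat list \<Rightarrow>
   'i set \<Rightarrow> ('i \<Rightarrow> 'h) \<Rightarrow> ('i \<Rightarrow> refelem) \<Rightarrow> (refelem \<Rightarrow> 'h) \<Rightarrow> bool" where
  "l2_row_decay ip \<alpha>s ns I f a e \<longleftrightarrow>
     (\<forall>\<epsilon>>0. \<exists>N>0. \<forall>i\<in>I.
        (\<lambda>j. (norm (ip (f i) (e j)))\<^sup>2)
          summable_on (carrier (refgroup \<alpha>s ns) - S_box \<alpha>s ns N (a i)) \<and>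
        (\<Sum>\<^sub>\<infinity>j\<in>carrier (refgroup \<alpha>s ns) - S_box \<alpha>s ns N (a i). (norm (ip (f i) (e j)))\<^sup>2) < \<epsilon>)"


section \<open>Measures\<close>

text \<open>
  The averaged numbers \<open>\<langle>f\<^sub>i, S\<^sup>-\<^sup>1 f\<^sub>i\<rangle>\<close> are real because the frame operator is positive, so
  taking the real part only serves to convert the type. The average over an empty box is \<open>0\<close>,
  by the convention \<open>x / 0 = 0\<close>. Values are extended reals for the sake of the limits
  inferior and superior.
\<close>

definition average_F ::
  "('k::real_or_complex \<Rightarrow> 'h::banach \<Rightarrow> 'h) \<Rightarrow> ('h \<Rightarrow> 'h \<Rightarrow> 'k) \<Rightarrow> real list \<Rightarrow> nat list \<Rightarrow>
   'i set \<Rightarrow> ('i \<Rightarrow> refelem) \<Rightarrow> ('i \<Rightarrow> 'h) \<Rightarrow> nat \<Rightarrow> refelem \<Rightarrow> real" where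
  "average_F smul ip \<alpha>s ns I a f N j =
     1 / real (card (I_box \<alpha>s ns I a N j)) *
     (\<Sum>i\<in>I_box \<alpha>s ns I a N j. re_part (ip (f i) (dual_frame smul ip I f i)))"

definition average_E ::
  "('k::real_or_complex \<Rightarrow> 'h::banach \<Rightarrow> 'h) \<Rightarrow> ('h \<Rightarrow> 'h \<Rightarrow> 'k) \<Rightarrow> real list \<Rightarrow> nat list \<Rightarrow>
   (refelem \<Rightarrow> 'h) \<Rightarrow> nat \<Rightarrow> refelem \<Rightarrow> real" where
  "average_E smul ip \<alpha>s ns e N j =
     1 / real (card (S_box \<alpha>s ns N j)) *
     (\<Sum>k\<in>S_box \<alpha>s ns N j.
        re_part (ip (dual_frame smul ip (carrier (refgroup \<alpha>s ns)) e k) (e k)))"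

definition measure_F where
  "measure_F smul ip \<alpha>s ns I a f p c =
     Lim p (\<lambda>N. ereal (average_F smul ip \<alpha>s ns I a f N (c N)))"

definition lower_measure_F where
  "lower_measure_F smul ip \<alpha>s ns I a f =
     liminf (\<lambda>N. INF j\<in>carrier (refgroup \<alpha>s ns). ereal (average_F smul ip \<alpha>s ns I a f N j))"

definition upper_measure_F where
  "upper_measure_F smul ip \<alpha>s ns I a f =
     limsup (\<lambda>N. SUP j\<in>carrier (refgroup \<alpha>s ns). ereal (average_F smul ip \<alpha>s ns I a f N j))"

definition measure_E where
  "measure_E smul ip \<alpha>s ns e p c =
     Lim p (\<lambda>N. ereal (average_E smul ip \<alpha>s ns e N (c N)))"

definition lower_measure_E where
  "lower_measure_E smul ip \<alpha>s ns e =
     liminf (\<lambda>N. INF j\<in>carrier (refgroup \<alpha>s ns). ereal (average_E smul ip \<alpha>s ns e N j))"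

definition upper_measure_E where
  "upper_measure_E smul ip \<alpha>s ns e =
     limsup (\<lambda>N. SUP j\<in>carrier (refgroup \<alpha>s ns). ereal (average_E smul ip \<alpha>s ns e N j))"

end

theory Submission
  imports Defs "HOL-Real_Asymp.Real_Asymp"
begin

text \<open>
  Call \<open>\<langle>f\<^sub>i, S\<^sup>-\<^sup>1 f\<^sub>i\<rangle>\<close> the leverage of the frame element \<open>f\<^sub>i\<close>. It is a diagonal entry of an orthogonal
  projection (the one onto the range of the analysis operator), so it lies between 0 and 1, and the
  measures in the theorem are limits of averaged leverages.

  The whole theorem rests on one estimate: uniformly in the centre \<open>j\<close>, the sum of the leverages of
  \<open>\<F>\<close> over \<open>I\<^sub>N(j)\<close> and the sum of those of \<open>\<E>\<close> over \<open>S\<^sub>N(j)\<close> differ by \<open>o(|S\<^sub>N(j)|)\<close>. The reason is that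
  both kinds of leverage are marginals of the single matrix with entries
  \<open>\<langle>f\<^sub>i, e\<^sub>k\<rangle> \<cdot> \<langle>S\<^sup>-\<^sup>1 e\<^sub>k, S\<^sup>-\<^sup>1 f\<^sub>i\<rangle>\<close> (with the frame operator of the respective frame): row \<open>i\<close> sums to the
  leverage of \<open>f\<^sub>i\<close>, because \<open>\<E>\<close> is a frame, and column \<open>k\<close> to that of \<open>e\<^sub>k\<close>, because \<open>\<F>\<close> is one. In the
  difference of the two sums the block \<open>I\<^sub>N(j) \<times> S\<^sub>N(j)\<close> cancels, and by Cauchy--Schwarz what is left
  of a row or column is small when its index lies well inside the box (this is the decay
  hypothesis) and bounded when the index lies near the boundary. Few indices lie near the
  boundary: the shells of boxes in \<open>G\<close> are negligible against the boxes, and finiteness of the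
  upper density bounds the fibres of \<open>a\<close>. This is \<open>leverage_sum_comparison\<close>, \<open>card_shell_small\<close>
  and \<open>finite_density_bounds_fibres\<close>, put together in \<open>averages_close\<close>.

  After division by \<open>|S\<^sub>N(j)|\<close> the estimate says that the averages over \<open>\<E>\<close> are, up to an error that is
  uniformly small for large \<open>N\<close>, the averages over \<open>\<F>\<close> times the ratios \<open>|I\<^sub>N(j)| / |S\<^sub>N(j)|\<close>. Along an
  ultrafilter all three families converge, which gives the product formula; the inequalities come
  from evaluating the approximate identity in boxes where one of the factors is almost extremal
  (\<open>uniform_product_limits\<close>). The leverages of a Riesz basis are all 1, and then the product formula
  determines the measures of \<open>\<F>\<close> from the densities.

  If the upper density exceeds \<open>\<M>\<^sup>+(\<E>)\<close>, then in boxes of almost maximal density the leverages of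
  \<open>\<F>\<close> have an average that stays below 1, so infinitely many of them are at most \<open>1 - \<delta>\<close> for some
  \<open>\<delta> > 0\<close>. An infinite set of such elements can be thinned out until its Gram matrix
  \<open>\<langle>f\<^sub>i, S\<^sup>-\<^sup>1 f\<^sub>k\<rangle>\<close> is almost diagonal, hence of norm less than 1; this norm is the largest fraction of the
  frame energy \<open>\<langle>S h, h\<rangle>\<close> that the removed elements can carry (\<open>remove_infinite_subset\<close>).
\<close>

section \<open>Scalars and square-summable families\<close>

lemma conjug_zero [simp]: "conjug (0 :: 'a::real_or_complex) = 0"
  using conjug_add[of "0 :: 'a" 0] by simp

lemma mult_conjug_of_real: "x * conjug x = of_real ((norm (x :: 'a::real_or_complex))\<^sup>2)"
  by (simp only: mult_conjug of_real_def)

lemma conjug_of_real [simp]: "conjug (of_real r :: 'a::real_or_complex) = of_real r"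
proof (cases "r = 0")
  case False
  have "of_real r * conjug (of_real r :: 'a) = of_real r * of_real r"
    by (subst mult_conjug_of_real) (simp add: power2_eq_square)
  with False show ?thesis by simp
qed simp

lemma norm_conjug [simp]: "norm (conjug x) = norm (x :: 'a::real_or_complex)"
proof -
  have "of_real ((norm (conjug x))\<^sup>2) = (of_real ((norm x)\<^sup>2) :: 'a)"
    using mult_conjug_of_real[of x] mult_conjug_of_real[of "conjug x"]
    by (simp add: conjug_conjug mult.commute)
  then show ?thesis by (simp only: of_real_eq_iff) simp
qed

lemma add_conjug_of_real: "x + conjug x = of_real (2 * re_part (x :: 'a::real_or_complex))"
  by (simp only: add_conjug of_real_def)

lemma re_part_of_real [simp]: "re_part (of_real r :: 'a::real_or_complex) = r"
proof -
  have "of_real (2 * re_part (of_real r :: 'a)) = (of_real (2 * r) :: 'a)"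
    by (subst add_conjug_of_real[symmetric]) simp
  then show ?thesis by (simp only: of_real_eq_iff)
qed

lemma re_part_conjug [simp]: "re_part (conjug x :: 'a::real_or_complex) = re_part x"
proof -
  have "of_real (2 * re_part (conjug x)) = (of_real (2 * re_part x) :: 'a)"
    by (simp only: add_conjug_of_real[symmetric] conjug_conjug add.commute)
  then show ?thesis by (simp only: of_real_eq_iff)
qed

lemma bounded_linear_conjug: "bounded_linear (conjug :: 'a::real_or_complex \<Rightarrow> 'a)"
  by (rule bounded_linear_intro[where K = 1])
     (simp_all add: conjug_add scaleR_conv_of_real conjug_mult)

lemma has_sum_conjug:
  "(g has_sum s) A \<Longrightarrow> ((\<lambda>i. conjug (g i)) has_sum conjug (s :: 'a::real_or_complex)) A"
  using has_sum_bounded_linear[OF bounded_linear_conjug] by blast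

lemma norm_sum_mult_le_sqrt:
  fixes u v :: "'i \<Rightarrow> 'a::real_normed_field"
  assumes u: "(\<Sum>i\<in>F. (norm (u i))\<^sup>2) \<le> p" and v: "(\<Sum>i\<in>F. (norm (v i))\<^sup>2) \<le> q"
  shows "norm (\<Sum>i\<in>F. u i * v i) \<le> sqrt p * sqrt q"
proof -
  have "norm (\<Sum>i\<in>F. u i * v i) \<le> (\<Sum>i\<in>F. \<bar>norm (u i)\<bar> * \<bar>norm (v i)\<bar>)"
    by (rule order.trans[OF norm_sum]) (simp add: norm_mult)
  also have "\<dots> \<le> L2_set (\<lambda>i. norm (u i)) F * L2_set (\<lambda>i. norm (v i)) F"
    by (rule L2_set_mult_ineq)
  also have "\<dots> \<le> sqrt p * sqrt q"
  proof -
    have "0 \<le> p" using sum_nonneg[of F "\<lambda>i. (norm (u i))\<^sup>2"] u by simp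
    then show ?thesis
      unfolding L2_set_def using u v by (intro mult_mono real_sqrt_le_mono) (auto intro: sum_nonneg)
  qed
  finally show ?thesis .
qed

text \<open>
  The square sums are bounded on finite sets only, so that the lemma can be fed with Bessel bounds
  directly; such a bound survives the passage to the limit.
\<close>

lemma norm_has_sum_mult_le_sqrt:
  fixes u v :: "'i \<Rightarrow> 'a::real_normed_field"
  assumes s: "((\<lambda>i. u i * v i) has_sum s) A"
    and u: "\<And>F. finite F \<Longrightarrow> F \<subseteq> A \<Longrightarrow> (\<Sum>i\<in>F. (norm (u i))\<^sup>2) \<le> p"
    and v: "\<And>F. finite F \<Longrightarrow> F \<subseteq> A \<Longrightarrow> (\<Sum>i\<in>F. (norm (v i))\<^sup>2) \<le> q"
  shows "norm s \<le> sqrt p * sqrt q"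
proof (rule tendsto_upperbound)
  show "((\<lambda>F. norm (\<Sum>i\<in>F. u i * v i)) \<longlongrightarrow> norm s) (finite_subsets_at_top A)"
    using s unfolding has_sum_def by (rule tendsto_norm)
  show "\<forall>\<^sub>F F in finite_subsets_at_top A. norm (\<Sum>i\<in>F. u i * v i) \<le> sqrt p * sqrt q"
    by (rule eventually_finite_subsets_at_top_weakI) (intro norm_sum_mult_le_sqrt u v)
qed simp

text \<open>
  The Cauchy criterion for unconditional convergence. Absolute convergence does not suffice for
  frame expansions, whose terms are in general not norm-summable.
\<close>

lemma summable_on_if_tails_small:
  fixes g :: "'i \<Rightarrow> 'b::banach"
  assumes small: "\<And>e. e > 0 \<Longrightarrow> \<exists>F0. finite F0 \<and> F0 \<subseteq> A \<and>
    (\<forall>F. finite F \<and> F \<subseteq> A - F0 \<longrightarrow> norm (sum g F) < e)"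
  shows "g summable_on A"
proof -
  have "\<exists>P. eventually P (finite_subsets_at_top A) \<and>
      (\<forall>F F'. P F \<and> P F' \<longrightarrow> dist (sum g F) (sum g F') < e)" if "e > 0" for e
  proof -
    from small[of "e / 2"] that obtain F0 where F0: "finite F0" "F0 \<subseteq> A"
      and tail: "\<And>F. finite F \<Longrightarrow> F \<subseteq> A - F0 \<Longrightarrow> norm (sum g F) < e / 2" by auto
    have near: "dist (sum g F) (sum g F0) < e / 2" if "finite F" "F0 \<subseteq> F" "F \<subseteq> A" for F
      using tail[of "F - F0"] that by (auto simp: dist_norm sum_diff)
    have "dist (sum g F) (sum g F') < e"
      if "finite F" "F0 \<subseteq> F" "F \<subseteq> A" "finite F'" "F0 \<subseteq> F'" "F' \<subseteq> A" for F F'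
      using near[of F] near[of F'] dist_triangle_half_l that by blast
    moreover have "\<forall>\<^sub>F F in finite_subsets_at_top A. finite F \<and> F0 \<subseteq> F \<and> F \<subseteq> A"
      using F0 unfolding eventually_finite_subsets_at_top by blast
    ultimately show ?thesis by (intro exI[of _ "\<lambda>F. finite F \<and> F0 \<subseteq> F \<and> F \<subseteq> A"]) blast
  qed
  then have "cauchy_filter (filtermap (sum g) (finite_subsets_at_top A))"
    by (simp add: cauchy_filter_metric_filtermap)
  moreover have "complete (UNIV :: 'b set)"
    by (meson Cauchy_convergent UNIV_I complete_def convergent_def)
  ultimately obtain l where "(sum g \<longlongrightarrow> l) (finite_subsets_at_top A)"
    using complete_uniform[where S = UNIV] by (force simp add: filterlim_def)
  then show ?thesis unfolding summable_on_def has_sum_def by blast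
qed

lemma summable_on_nonneg_tail:
  fixes g :: "'i \<Rightarrow> real"
  assumes "g summable_on A" and nonneg: "\<And>i. g i \<ge> 0" and "e > 0"
  obtains F0 where "finite F0" "F0 \<subseteq> A" "\<And>F. finite F \<Longrightarrow> F \<subseteq> A - F0 \<Longrightarrow> sum g F \<le> e"
proof -
  from infsum_finite_approximation[OF assms(1,3)] obtain F0
    where F0: "finite F0" "F0 \<subseteq> A" "dist (sum g F0) (infsum g A) \<le> e" by blast
  have "sum g F \<le> e" if "finite F" "F \<subseteq> A - F0" for F
  proof -
    have "sum g (F \<union> F0) \<le> infsum g A"
      using that F0 assms by (intro finite_sum_le_infsum) auto
    moreover have "sum g (F \<union> F0) = sum g F + sum g F0"
      using that F0 by (intro sum.union_disjoint) auto
    ultimately show ?thesis using F0(3) by (simp add: dist_real_def)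
  qed
  with F0 that show ?thesis by blast
qed

section \<open>Inner products and Bessel families\<close>

context hilbert_space
begin

lemma ip_add_right: "ip x (y + z) = ip x y + ip x z"
  by (subst (1 2 3) ip_commute) (simp only: ip_add_left conjug_add)

lemma ip_smul_right: "ip x (smul c y) = conjug c * ip x y"
  by (subst (1 2) ip_commute) (simp only: ip_smul_left conjug_mult)

lemma ip_zero_left [simp]: "ip 0 y = 0"
  using ip_add_left[of 0 0 y] by simp

lemma ip_zero_right [simp]: "ip x 0 = 0"
  using ip_add_right[of x 0 0] by simp

lemma ip_diff_left: "ip (x - y) z = ip x z - ip y z"
  using ip_add_left[of "x - y" y z] by simp

lemma ip_diff_right: "ip x (y - z) = ip x y - ip x z"
  using ip_add_right[of x "y - z" z] by simp

lemma ip_sum_left: "ip (\<Sum>i\<in>F. g i) y = (\<Sum>i\<in>F. ip (g i) y)"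
  by (induction F rule: infinite_finite_induct) (simp_all add: ip_add_left)

lemma norm_ip_commute: "norm (ip x y) = norm (ip y x)"
  by (simp only: ip_commute[of y x] norm_conjug)

lemma ip_mult_flip: "ip x y * ip y x = of_real ((norm (ip x y))\<^sup>2)"
  by (simp only: ip_commute[of y x] mult_conjug_of_real)

lemma norm_smul: "norm (smul c x) = norm c * norm x"
proof -
  have "of_real ((norm (smul c x))\<^sup>2) = (c * conjug c) * ip x x"
    by (simp only: ip_self[symmetric] ip_smul_left ip_smul_right ac_simps)
  also have "\<dots> = (of_real ((norm c * norm x)\<^sup>2) :: 'k)"
    by (simp add: mult_conjug_of_real ip_self power_mult_distrib)
  finally show ?thesis by (simp only: of_real_eq_iff) simp
qed

lemma norm_diff_sq: "(norm (x - y))\<^sup>2 = (norm x)\<^sup>2 - 2 * re_part (ip x y) + (norm y)\<^sup>2"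
proof -
  have "of_real ((norm (x - y))\<^sup>2) = ip x x - (ip x y + conjug (ip x y)) + ip y y"
    by (simp only: ip_self[symmetric] ip_diff_left ip_diff_right ip_commute[of y x]) (simp add: algebra_simps)
  also have "\<dots> = (of_real ((norm x)\<^sup>2 - 2 * re_part (ip x y) + (norm y)\<^sup>2) :: 'k)"
    by (simp add: ip_self add_conjug_of_real)
  finally show ?thesis by (simp only: of_real_eq_iff)
qed

lemma norm_ip_le: "norm (ip x y) \<le> norm x * norm y"
proof (cases "y = 0")
  case False
  define n where "n = (norm (ip x y))\<^sup>2"
  \<comment> \<open>With this \<open>t\<close>, \<open>smul c y\<close> is the orthogonal projection of \<open>x\<close> onto the line through \<open>y\<close>.\<close>
  define t where "t = 1 / (norm y)\<^sup>2"
  define c where "c = of_real t * ip x y"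
  have "re_part (ip x (smul c y)) = t * n"
  proof -
    have "ip x (smul c y) = of_real t * (ip x y * conjug (ip x y))"
      by (simp add: c_def ip_smul_right conjug_mult)
    also have "\<dots> = of_real (t * n)" by (simp add: mult_conjug_of_real n_def)
    finally show ?thesis by (simp only: re_part_of_real)
  qed
  moreover have "(norm (smul c y))\<^sup>2 = t\<^sup>2 * n * (norm y)\<^sup>2"
    by (simp add: norm_smul c_def norm_mult power_mult_distrib n_def)
  ultimately have "0 \<le> (norm x)\<^sup>2 - 2 * (t * n) + t\<^sup>2 * n * (norm y)\<^sup>2"
    using norm_diff_sq[of x "smul c y"] by (metis zero_le_power2)
  moreover have "t\<^sup>2 * n * (norm y)\<^sup>2 = t * n"
    using False by (simp add: t_def power2_eq_square)
  ultimately have "n \<le> (norm x)\<^sup>2 * (norm y)\<^sup>2"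
    using False by (simp add: t_def field_simps)
  then show ?thesis
    unfolding n_def power_mult_distrib[symmetric] by (rule power2_le_imp_le) simp
qed simp

lemma bounded_linear_ip: "bounded_linear (\<lambda>x. ip x y)"
proof (rule bounded_linear_intro[where K = "norm y"])
  show "ip (r *\<^sub>R x) y = r *\<^sub>R ip x y" for r x
    by (simp add: smul_of_real[symmetric] ip_smul_left scaleR_conv_of_real)
qed (simp_all add: ip_add_left norm_ip_le)

text \<open>
  The scalar expansions below arise in this way from convergent series of vectors, whose space is
  complete. The axioms for the scalars do not include completeness, so convergence of such an
  expansion is not deduced from absolute convergence.
\<close>

lemma has_sum_ip: "(g has_sum x) A \<Longrightarrow> ((\<lambda>i. ip (g i) y) has_sum ip x y) A"
  using has_sum_bounded_linear[OF bounded_linear_ip] by blast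

text \<open>
  The synthesis map \<open>c \<mapsto> \<Sum> c\<^sub>i f\<^sub>i\<close> is adjoint to the analysis map that the hypothesis bounds: test
  the vector against itself.
\<close>

lemma norm_synthesis_le:
  assumes bessel: "\<And>h. (\<Sum>i\<in>F. (norm (ip h (f i)))\<^sup>2) \<le> B * (norm h)\<^sup>2" and B: "B \<ge> 0"
  shows "(norm (\<Sum>i\<in>F. smul (c i) (f i)))\<^sup>2 \<le> B * (\<Sum>i\<in>F. (norm (c i))\<^sup>2)"
proof (cases "(\<Sum>i\<in>F. smul (c i) (f i)) = 0")
  case True
  with B show ?thesis by (simp add: sum_nonneg)
next
  case False
  define v where "v = (\<Sum>i\<in>F. smul (c i) (f i))"
  have "(norm v)\<^sup>2 = norm (ip v v)" unfolding ip_self norm_of_real by simp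
  also have "ip v v = (\<Sum>i\<in>F. c i * ip (f i) v)"
    unfolding v_def by (simp only: ip_sum_left ip_smul_left)
  also have "norm \<dots> \<le> sqrt (\<Sum>i\<in>F. (norm (c i))\<^sup>2) * sqrt (B * (norm v)\<^sup>2)"
    using bessel[of v] by (intro norm_sum_mult_le_sqrt) (simp_all only: norm_ip_commute[of v] order.refl)
  also have "\<dots> = sqrt (B * (\<Sum>i\<in>F. (norm (c i))\<^sup>2)) * norm v"
    by (simp add: real_sqrt_mult)
  finally have "norm v \<le> sqrt (B * (\<Sum>i\<in>F. (norm (c i))\<^sup>2))"
    using False unfolding v_def[symmetric] by (simp add: power2_eq_square)
  then have "(norm v)\<^sup>2 \<le> (sqrt (B * (\<Sum>i\<in>F. (norm (c i))\<^sup>2)))\<^sup>2"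
    by (rule power_mono) simp
  also have "\<dots> = B * (\<Sum>i\<in>F. (norm (c i))\<^sup>2)"
    using B by (simp add: sum_nonneg)
  finally show ?thesis unfolding v_def .
qed

lemma synthesis_summable_on:
  assumes bessel: "\<And>h F. finite F \<Longrightarrow> F \<subseteq> A \<Longrightarrow> (\<Sum>i\<in>F. (norm (ip h (f i)))\<^sup>2) \<le> B * (norm h)\<^sup>2"
    and B: "B > 0" and c: "(\<lambda>i. (norm (c i))\<^sup>2) summable_on A"
  shows "(\<lambda>i. smul (c i) (f i)) summable_on A"
proof (rule summable_on_if_tails_small)
  fix \<epsilon> :: real assume "\<epsilon> > 0"
  then have "(\<epsilon> / 2)\<^sup>2 / B > 0" using B by simp
  from summable_on_nonneg_tail[OF c _ this] obtain F0
    where F0: "finite F0" "F0 \<subseteq> A"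
      and tail: "\<And>F. finite F \<Longrightarrow> F \<subseteq> A - F0 \<Longrightarrow> (\<Sum>i\<in>F. (norm (c i))\<^sup>2) \<le> (\<epsilon> / 2)\<^sup>2 / B"
    by auto
  have "norm (\<Sum>i\<in>F. smul (c i) (f i)) < \<epsilon>" if F: "finite F" "F \<subseteq> A - F0" for F
  proof -
    have "(norm (\<Sum>i\<in>F. smul (c i) (f i)))\<^sup>2 \<le> B * (\<Sum>i\<in>F. (norm (c i))\<^sup>2)"
      using bessel F B by (intro norm_synthesis_le) auto
    also have "\<dots> \<le> (\<epsilon> / 2)\<^sup>2"
      using tail[OF F] B by (simp add: pos_le_divide_eq mult.commute)
    finally have "norm (\<Sum>i\<in>F. smul (c i) (f i)) \<le> \<epsilon> / 2"
      by (rule power2_le_imp_le) (use \<open>\<epsilon> > 0\<close> in simp)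
    with \<open>\<epsilon> > 0\<close> show ?thesis by simp
  qed
  with F0 show "\<exists>F0. finite F0 \<and> F0 \<subseteq> A \<and>
    (\<forall>F. finite F \<and> F \<subseteq> A - F0 \<longrightarrow> norm (\<Sum>i\<in>F. smul (c i) (f i)) < \<epsilon>)" by blast
qed

end

section \<open>The frame operator and the canonical dual frame\<close>

lemma le_if_square_le:
  fixes x y :: real
  assumes "x * x \<le> y * x" "0 \<le> x" "0 \<le> y"
  shows "x \<le> y"
  using assms by (cases "x = 0") (auto simp: mult_le_cancel_right)

locale framed = hilbert_space smul ip
  for smul :: "'k::real_or_complex \<Rightarrow> 'h::banach \<Rightarrow> 'h" and ip :: "'h \<Rightarrow> 'h \<Rightarrow> 'k" +
  fixes I :: "'i set" and f :: "'i \<Rightarrow> 'h" and A B :: real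
  assumes lower_pos: "0 < A" and upper_pos: "0 < B"
    and coeff_summable: "(\<lambda>i. (norm (ip h (f i)))\<^sup>2) summable_on I"
    and lower_bound: "A * (norm h)\<^sup>2 \<le> (\<Sum>\<^sub>\<infinity>i\<in>I. (norm (ip h (f i)))\<^sup>2)"
    and upper_bound: "(\<Sum>\<^sub>\<infinity>i\<in>I. (norm (ip h (f i)))\<^sup>2) \<le> B * (norm h)\<^sup>2"

lemma (in hilbert_space) framed_if_is_frame:
  assumes "is_frame ip I f"
  obtains A B where "framed smul ip I f A B"
  using assms that hilbert_space_axioms
  unfolding is_frame_def framed_def framed_axioms_def by blast

context framed
begin

abbreviation S :: "'h \<Rightarrow> 'h" where "S \<equiv> frame_operator smul ip I f"
abbreviation dual :: "'i \<Rightarrow> 'h" where "dual \<equiv> dual_frame smul ip I f"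
abbreviation Sinv :: "'h \<Rightarrow> 'h" where "Sinv \<equiv> inv_into UNIV S"

text \<open>
  The quadratic form of the frame operator (see \<open>ip_S_self\<close> below). Estimates in terms of this form
  replace those that would use the square root of the operator.
\<close>

definition energy :: "'h \<Rightarrow> real" where
  "energy h = (\<Sum>\<^sub>\<infinity>i\<in>I. (norm (ip h (f i)))\<^sup>2)"

lemma lower_energy: "A * (norm h)\<^sup>2 \<le> energy h"
  and upper_energy: "energy h \<le> B * (norm h)\<^sup>2"
  unfolding energy_def by (rule lower_bound upper_bound)+

lemma energy_nonneg: "0 \<le> energy h"
  using lower_energy[of h] lower_pos by (meson mult_nonneg_nonneg less_imp_le order.trans zero_le_power2)

lemma finite_energy_le:
  assumes "finite F" "F \<subseteq> I"
  shows "(\<Sum>i\<in>F. (norm (ip h (f i)))\<^sup>2) \<le> energy h"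
  unfolding energy_def by (rule finite_sum_le_infsum[OF coeff_summable assms]) simp

lemma bessel:
  assumes "finite F" "F \<subseteq> I"
  shows "(\<Sum>i\<in>F. (norm (ip h (f i)))\<^sup>2) \<le> B * (norm h)\<^sup>2"
  using finite_energy_le[OF assms] upper_energy order.trans by blast

lemma has_sum_S: "((\<lambda>i. smul (ip h (f i)) (f i)) has_sum S h) I"
  unfolding frame_operator_def
  by (intro has_sum_infsum synthesis_summable_on[OF bessel upper_pos coeff_summable])

lemma has_sum_ip_S: "((\<lambda>i. ip h (f i) * ip (f i) y) has_sum ip (S h) y) I"
  using has_sum_ip[OF has_sum_S] by (simp add: ip_smul_left)

lemma ip_S_commute: "ip (S h) y = ip h (S y)"
proof -
  have "((\<lambda>i. conjug (ip y (f i) * ip (f i) h)) has_sum conjug (ip (S y) h)) I"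
    by (rule has_sum_conjug) (rule has_sum_ip_S)
  then have "((\<lambda>i. ip h (f i) * ip (f i) y) has_sum ip h (S y)) I"
    by (simp only: conjug_mult ip_commute[symmetric] mult.commute[of "ip h _"])
  with has_sum_ip_S show ?thesis by (rule has_sum_unique)
qed

lemma ip_S_self: "ip (S h) h = of_real (energy h)"
proof -
  have "((\<lambda>i. of_real ((norm (ip h (f i)))\<^sup>2)) has_sum ip (S h) h) I"
    using has_sum_ip_S[of h h] by (simp only: ip_mult_flip)
  moreover have "((\<lambda>i. of_real ((norm (ip h (f i)))\<^sup>2)) has_sum (of_real (energy h) :: 'k)) I"
    unfolding energy_def by (intro has_sum_of_real has_sum_infsum coeff_summable)
  ultimately show ?thesis by (rule has_sum_unique)
qed

text \<open>
  Cauchy--Schwarz for the form \<open>\<langle>S x, y\<rangle> = \<Sum> \<langle>x, f\<^sub>i\<rangle> \<langle>f\<^sub>i, y\<rangle>\<close>, from the one for square-summable families.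
\<close>

lemma norm_ip_S_sq_le: "(norm (ip (S x) y))\<^sup>2 \<le> energy x * energy y"
proof -
  have "norm (ip (S x) y) \<le> sqrt (energy x) * sqrt (energy y)"
    by (rule norm_has_sum_mult_le_sqrt[OF has_sum_ip_S])
       (simp_all only: norm_ip_commute[of _ y] finite_energy_le)
  then have "(norm (ip (S x) y))\<^sup>2 \<le> (sqrt (energy x) * sqrt (energy y))\<^sup>2"
    by (rule power_mono) simp
  then show ?thesis by (simp add: power_mult_distrib energy_nonneg)
qed

lemma norm_S_le: "norm (S x) \<le> B * norm x"
proof -
  have "(norm (S x))\<^sup>2 * (norm (S x))\<^sup>2 = (norm (ip (S x) (S x)))\<^sup>2"
    unfolding ip_self norm_of_real by (simp add: power2_eq_square)
  also have "\<dots> \<le> energy x * energy (S x)" by (rule norm_ip_S_sq_le)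
  also have "\<dots> \<le> (B * (norm x)\<^sup>2) * (B * (norm (S x))\<^sup>2)"
    using upper_pos by (intro mult_mono upper_energy energy_nonneg) simp_all
  also have "\<dots> = (B * norm x)\<^sup>2 * (norm (S x))\<^sup>2"
    by (simp add: power2_eq_square ac_simps)
  finally have "(norm (S x))\<^sup>2 \<le> (B * norm x)\<^sup>2"
    by (rule le_if_square_le) simp_all
  then show ?thesis by (rule power2_le_imp_le) (use upper_pos in simp)
qed

lemma S_diff: "S (x - y) = S x - S y"
proof -
  have "((\<lambda>i. smul (ip x (f i)) (f i) + (- smul (ip y (f i)) (f i))) has_sum S x + (- S y)) I"
    by (intro has_sum_add has_sum_S) (simp add: has_sum_uminus has_sum_S)
  then have "((\<lambda>i. smul (ip (x - y) (f i)) (f i)) has_sum S x - S y) I"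
    by (simp add: ip_diff_left scale_left_diff_distrib)
  with has_sum_S show ?thesis by (rule has_sum_unique)
qed

text \<open>
  Injectivity is the lower frame bound. For surjectivity, \<open>x \<mapsto> x - \<tau> (S x - y)\<close> is a contraction for
  a suitable \<open>\<tau>\<close>, and its fixed point solves \<open>S x = y\<close>.
\<close>

lemma bij_S: "bij S"
proof (rule bijI)
  show "inj S"
  proof (rule injI)
    fix x y assume "S x = S y"
    then have "of_real (energy (x - y)) = (0 :: 'k)"
      by (simp add: S_diff ip_S_self[symmetric])
    then have "A * (norm (x - y))\<^sup>2 \<le> 0" using lower_energy[of "x - y"] by simp
    then show "x = y" using lower_pos by (simp add: mult_le_0_iff)
  qed
  show "surj S"
  proof (rule surjI[where f = Sinv])
    fix y
    \<comment> \<open>This \<open>\<tau>\<close> minimizes \<open>1 - 2 \<tau> A + \<tau>\<^sup>2 B\<^sup>2\<close>, a bound for the square of the norm of \<open>1 - \<tau> S\<close>.\<close>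
    define \<tau> where "\<tau> = A / B\<^sup>2"
    define T where "T x = x - \<tau> *\<^sub>R S x + \<tau> *\<^sub>R y" for x
    have \<tau>: "\<tau> > 0" using lower_pos upper_pos by (simp add: \<tau>_def)
    \<comment> \<open>On the zero space \<open>A\<close> may exceed \<open>B\<close>; the maximum keeps the square root meaningful.\<close>
    define \<kappa> where "\<kappa> = max 0 (1 - \<tau> * A)"
    have contraction: "norm (z - \<tau> *\<^sub>R S z) \<le> sqrt \<kappa> * norm z" for z
    proof -
      have "re_part (ip z (\<tau> *\<^sub>R S z)) = \<tau> * energy z"
      proof -
        have "ip z (\<tau> *\<^sub>R S z) = of_real \<tau> * ip (S z) z"
          by (simp add: smul_of_real[symmetric] ip_smul_right ip_S_commute)
        also have "\<dots> = of_real (\<tau> * energy z)" by (simp add: ip_S_self)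
        finally show ?thesis by (simp only: re_part_of_real)
      qed
      then have "(norm (z - \<tau> *\<^sub>R S z))\<^sup>2 = (norm z)\<^sup>2 - 2 * (\<tau> * energy z) + (\<tau> * norm (S z))\<^sup>2"
        using \<tau> by (simp add: norm_diff_sq)
      also have "(\<tau> * norm (S z))\<^sup>2 \<le> (\<tau> * (B * norm z))\<^sup>2"
        using \<tau> norm_S_le by (intro power_mono mult_left_mono) auto
      also have "(\<tau> * (B * norm z))\<^sup>2 = \<tau> * (A * (norm z)\<^sup>2)"
        using upper_pos by (simp add: \<tau>_def power2_eq_square)
      finally have "(norm (z - \<tau> *\<^sub>R S z))\<^sup>2
          \<le> (norm z)\<^sup>2 - 2 * (\<tau> * energy z) + \<tau> * (A * (norm z)\<^sup>2)" by simp
      moreover have "\<tau> * (A * (norm z)\<^sup>2) \<le> \<tau> * energy z"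
        using \<tau> lower_energy by (intro mult_left_mono) auto
      ultimately have "(norm (z - \<tau> *\<^sub>R S z))\<^sup>2 \<le> (1 - \<tau> * A) * (norm z)\<^sup>2"
        by (simp add: algebra_simps)
      also have "\<dots> \<le> \<kappa> * (norm z)\<^sup>2" unfolding \<kappa>_def by (intro mult_right_mono) auto
      also have "\<dots> = (sqrt \<kappa> * norm z)\<^sup>2" by (simp add: power_mult_distrib \<kappa>_def)
      finally show ?thesis by (rule power2_le_imp_le) (simp add: \<kappa>_def)
    qed
    have "\<exists>!x. T x = x"
    proof (rule banach_fix_type)
      show "sqrt \<kappa> < 1" using \<tau> lower_pos by (simp add: \<kappa>_def)
      show "\<forall>x x'. dist (T x) (T x') \<le> sqrt \<kappa> * dist x x'"
      proof (intro allI)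
        fix x x'
        have "T x - T x' = (x - x') - \<tau> *\<^sub>R S (x - x')"
          by (simp add: T_def S_diff algebra_simps)
        then show "dist (T x) (T x') \<le> sqrt \<kappa> * dist x x'"
          using contraction[of "x - x'"] by (simp add: dist_norm)
      qed
    qed (simp add: \<kappa>_def)
    then obtain x where "T x = x" by blast
    then have "\<tau> *\<^sub>R S x = \<tau> *\<^sub>R y" by (auto simp: T_def algebra_simps)
    with \<tau> have "S x = y" by auto
    then show "S (Sinv y) = y" by (auto intro: f_inv_into_f)
  qed
qed

lemma S_Sinv [simp]: "S (Sinv x) = x"
  by (rule surj_f_inv_f) (rule bij_is_surj[OF bij_S])

lemma dual_eq: "dual i = Sinv (f i)"
  by (simp add: dual_frame_def)

lemma ip_Sinv_commute: "ip (Sinv x) y = ip x (Sinv y)"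
  using ip_S_commute[of "Sinv x" "Sinv y"] by simp

lemma ip_Sinv_frame: "ip (Sinv x) (f i) = ip x (dual i)"
  by (simp add: ip_Sinv_commute dual_eq)

text \<open>
  The three expansions are \<open>S S\<^sup>-\<^sup>1 x = x\<close> and its weak forms, with \<open>S\<close> written out as a series.
\<close>

lemma dual_expansion: "((\<lambda>i. smul (ip x (dual i)) (f i)) has_sum x) I"
  using has_sum_S[of "Sinv x"] by (simp add: ip_Sinv_frame)

lemma ip_dual_frame_expansion: "((\<lambda>i. ip x (dual i) * ip (f i) y) has_sum ip x y) I"
  using has_sum_ip_S[of "Sinv x" y] by (simp add: ip_Sinv_frame)

lemma ip_frame_dual_expansion: "((\<lambda>i. ip x (f i) * ip (dual i) y) has_sum ip x y) I"
proof -
  have "ip (S x) (Sinv y) = ip x y" by (simp add: ip_S_commute)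
  then show ?thesis
    using has_sum_ip_S[of x "Sinv y"] by (simp add: dual_eq ip_Sinv_commute)
qed

lemma norm_Sinv_le: "norm (Sinv x) \<le> norm x / A"
proof -
  have "A * (norm (Sinv x))\<^sup>2 \<le> norm (ip (S (Sinv x)) (Sinv x))"
    unfolding ip_S_self norm_of_real using lower_energy[of "Sinv x"] by linarith
  also have "\<dots> \<le> norm x * norm (Sinv x)" unfolding S_Sinv by (rule norm_ip_le)
  finally have "norm (Sinv x) * norm (Sinv x) \<le> norm x / A * norm (Sinv x)"
    using lower_pos by (simp add: power2_eq_square field_simps)
  then show ?thesis by (rule le_if_square_le) (use lower_pos in simp_all)
qed

lemma dual_bessel:
  assumes "finite F" "F \<subseteq> I"
  shows "(\<Sum>i\<in>F. (norm (ip x (dual i)))\<^sup>2) \<le> (norm x)\<^sup>2 / A"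
proof -
  have "(\<Sum>i\<in>F. (norm (ip x (dual i)))\<^sup>2) \<le> energy (Sinv x)"
    using finite_energy_le[OF assms, of "Sinv x"] by (simp add: ip_Sinv_frame)
  also have "\<dots> \<le> norm (ip (S (Sinv x)) (Sinv x))"
    unfolding ip_S_self norm_of_real by simp
  also have "\<dots> \<le> norm x * norm (Sinv x)" unfolding S_Sinv by (rule norm_ip_le)
  also have "\<dots> \<le> norm x * (norm x / A)" by (intro mult_left_mono norm_Sinv_le) simp
  finally show ?thesis by (simp add: power2_eq_square)
qed

lemma norm_frame_sq_le:
  assumes "i \<in> I"
  shows "(norm (f i))\<^sup>2 \<le> B"
proof -
  have "(norm (f i))\<^sup>2 * (norm (f i))\<^sup>2 = (norm (ip (f i) (f i)))\<^sup>2"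
    unfolding ip_self norm_of_real by (simp add: power2_eq_square)
  also have "\<dots> = (\<Sum>k\<in>{i}. (norm (ip (f i) (f k)))\<^sup>2)" by simp
  also have "\<dots> \<le> B * (norm (f i))\<^sup>2" using assms by (intro bessel) auto
  finally show ?thesis by (rule le_if_square_le) (use upper_pos in simp_all)
qed

lemma norm_dual_sq_le:
  assumes "i \<in> I"
  shows "(norm (dual i))\<^sup>2 \<le> B / A\<^sup>2"
proof -
  have "(norm (dual i))\<^sup>2 \<le> (norm (f i) / A)\<^sup>2"
    unfolding dual_eq by (intro power_mono norm_Sinv_le) simp
  also have "\<dots> \<le> B / A\<^sup>2"
    using norm_frame_sq_le[OF assms] by (simp add: power_divide divide_right_mono)
  finally show ?thesis .
qed

text \<open>
  The name is the one used in statistics for the diagonal of the projection onto the range of a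
  design matrix.
\<close>

definition leverage :: "'i \<Rightarrow> real" where
  "leverage i = re_part (ip (f i) (dual i))"

lemma leverage_eq_energy: "leverage i = energy (dual i)"
  and ip_frame_dual: "ip (f i) (dual i) = of_real (leverage i)"
proof -
  have "ip (f i) (dual i) = of_real (energy (dual i))"
    using ip_S_self[of "dual i"] by (simp add: dual_eq)
  then show "leverage i = energy (dual i)" "ip (f i) (dual i) = of_real (leverage i)"
    unfolding leverage_def by simp_all
qed

lemma leverage_nonneg: "0 \<le> leverage i"
  unfolding leverage_eq_energy by (rule energy_nonneg)

text \<open>
  A projection \<open>P = P\<^sup>2\<close> satisfies \<open>P\<^sub>i\<^sub>i = \<Sum>\<^sub>k |P\<^sub>i\<^sub>k|\<^sup>2 \<ge> P\<^sub>i\<^sub>i\<^sup>2\<close>. Here \<open>P\<^sub>i\<^sub>k = \<langle>S\<^sup>-\<^sup>1 f\<^sub>i, f\<^sub>k\<rangle>\<close>.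
\<close>

lemma leverage_le_1:
  assumes "i \<in> I"
  shows "leverage i \<le> 1"
proof -
  have "(leverage i)\<^sup>2 = (\<Sum>k\<in>{i}. (norm (ip (dual i) (f k)))\<^sup>2)"
    by (simp add: norm_ip_commute[of "dual i"] ip_frame_dual)
  also have "\<dots> \<le> leverage i"
    unfolding leverage_eq_energy using assms by (intro finite_energy_le) auto
  finally have "leverage i * leverage i \<le> 1 * leverage i" by (simp add: power2_eq_square)
  then show ?thesis by (rule le_if_square_le) (simp_all add: leverage_nonneg)
qed

end

section \<open>Comparing the leverages of two frames\<close>

text \<open>
  The set \<open>P'\<close> is the core of the box \<open>P\<close>, where the summands are small; on the shell \<open>P - P'\<close> they
  are merely bounded.
\<close>

lemma norm_sum_le_core_shell:
  fixes r :: "'i \<Rightarrow> 'a::real_normed_vector"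
  assumes P: "finite P" "P' \<subseteq> P" and nonneg: "0 \<le> K" "0 \<le> s"
    and core: "\<And>i. i \<in> P' \<Longrightarrow> norm (r i) \<le> K * s"
    and shell: "\<And>i. i \<in> P - P' \<Longrightarrow> norm (r i) \<le> K"
  shows "norm (sum r P) \<le> K * (s * real (card P) + real (card (P - P')))"
proof -
  have "norm (sum r P) \<le> (\<Sum>i\<in>P. K * s + (if i \<in> P - P' then K else 0))"
  proof (intro sum_norm_le)
    fix i assume "i \<in> P"
    then show "norm (r i) \<le> K * s + (if i \<in> P - P' then K else 0)"
      using core[of i] shell[of i] nonneg by (cases "i \<in> P'") (auto intro: add_increasing)
  qed
  also have "\<dots> = K * s * real (card P) + K * real (card (P - P'))"
    using P by (simp add: sum.distrib sum.If_cases Int_absorb1 mult.commute flip: Collect_mem_eq) (simp add: Diff_eq Compl_eq)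
  finally show ?thesis by (simp add: algebra_simps)
qed

locale frame_pair =
  F: framed smul ip I f A B + E: framed smul ip G e A' B'
  for smul :: "'k::real_or_complex \<Rightarrow> 'h::banach \<Rightarrow> 'h" and ip :: "'h \<Rightarrow> 'h \<Rightarrow> 'k"
    and I :: "'i set" and f :: "'i \<Rightarrow> 'h" and A B :: real
    and G :: "'g set" and e :: "'g \<Rightarrow> 'h" and A' B' :: real
begin

text \<open>
  The sets \<open>P\<close> and \<open>Q\<close> play the roles of \<open>I\<^sub>N(j)\<close> and \<open>S\<^sub>N(j)\<close>, and \<open>P'\<close> and \<open>Q'\<close> those of smaller concentric
  boxes. Since \<open>K\<close> depends only on the frames, the estimate is uniform over all boxes.
\<close>

lemma leverage_sum_comparison:
  obtains K where "0 \<le> K" and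
    "\<And>P P' Q Q' \<epsilon>. \<lbrakk>finite P; P \<subseteq> I; P' \<subseteq> P; finite Q; Q \<subseteq> G; Q' \<subseteq> Q; 0 \<le> \<epsilon>;
       \<And>i F. i \<in> P' \<Longrightarrow> finite F \<Longrightarrow> F \<subseteq> G - Q \<Longrightarrow> (\<Sum>k\<in>F. (norm (ip (f i) (e k)))\<^sup>2) \<le> \<epsilon>;
       \<And>k F. k \<in> Q' \<Longrightarrow> finite F \<Longrightarrow> F \<subseteq> I - P \<Longrightarrow> (\<Sum>i\<in>F. (norm (ip (f i) (e k)))\<^sup>2) \<le> \<epsilon>\<rbrakk> \<Longrightarrow>
     \<bar>sum F.leverage P - sum E.leverage Q\<bar>
       \<le> K * (sqrt \<epsilon> * real (card P) + real (card (P - P')))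
         + K * (sqrt \<epsilon> * real (card Q) + real (card (Q - Q')))"
proof -
  define C where "C = max (B / A\<^sup>2 / A') (B' / A'\<^sup>2 / A)"
  \<comment> \<open>\<open>C\<close> bounds the square sums of the dual coefficients along rows and columns, \<open>B B'\<close> those of
    the cross coefficients \<open>\<langle>f\<^sub>i, e\<^sub>k\<rangle>\<close>. The first entry of the maximum serves the cores, the second the shells.\<close>
  define K where "K = max (sqrt C) (sqrt (B * B') * sqrt C)"
  have C: "0 \<le> C"
    unfolding C_def using F.lower_pos F.upper_pos by (simp add: le_max_iff_disj E.lower_pos less_imp_le)
  then have K: "0 \<le> K" unfolding K_def by (simp add: le_max_iff_disj)
  define T where "T i k = ip (f i) (e k) * ip (E.dual k) (F.dual i)" for i k
  have row_sum: "((\<lambda>k. T i k) has_sum of_real (F.leverage i)) G" for i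
    using E.ip_frame_dual_expansion[of "f i" "F.dual i"] by (simp add: T_def F.ip_frame_dual)
  have col_sum: "((\<lambda>i. T i k) has_sum of_real (E.leverage k)) I" for k
  proof -
    have "ip (E.dual k) (e k) = of_real (E.leverage k)"
      by (subst F.ip_commute) (simp add: E.ip_frame_dual)
    then show ?thesis
      using F.ip_dual_frame_expansion[of "E.dual k" "e k"] by (simp add: T_def mult.commute)
  qed
  have dual_row: "(\<Sum>k\<in>F. (norm (ip (E.dual k) (F.dual i)))\<^sup>2) \<le> C"
    if "i \<in> I" "finite F" "F \<subseteq> G" for i F
  proof -
    have "(\<Sum>k\<in>F. (norm (ip (E.dual k) (F.dual i)))\<^sup>2) \<le> (norm (F.dual i))\<^sup>2 / A'"
      using E.dual_bessel[OF that(2,3)] by (simp add: F.norm_ip_commute[of _ "F.dual i"])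
    also have "\<dots> \<le> B / A\<^sup>2 / A'"
      using F.norm_dual_sq_le[OF that(1)] E.lower_pos by (intro divide_right_mono) auto
    also have "\<dots> \<le> C" by (simp add: C_def)
    finally show ?thesis .
  qed
  have dual_col: "(\<Sum>i\<in>F. (norm (ip (E.dual k) (F.dual i)))\<^sup>2) \<le> C"
    if "k \<in> G" "finite F" "F \<subseteq> I" for k F
  proof -
    have "(\<Sum>i\<in>F. (norm (ip (E.dual k) (F.dual i)))\<^sup>2) \<le> (norm (E.dual k))\<^sup>2 / A"
      by (rule F.dual_bessel[OF that(2,3)])
    also have "\<dots> \<le> B' / A'\<^sup>2 / A"
      using E.norm_dual_sq_le[OF that(1)] F.lower_pos by (intro divide_right_mono) auto
    also have "\<dots> \<le> C" by (simp add: C_def)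
    finally show ?thesis .
  qed
  have cross_row: "(\<Sum>k\<in>F. (norm (ip (f i) (e k)))\<^sup>2) \<le> B * B'"
    if "i \<in> I" "finite F" "F \<subseteq> G" for i F
  proof -
    have "(\<Sum>k\<in>F. (norm (ip (f i) (e k)))\<^sup>2) \<le> B' * (norm (f i))\<^sup>2"
      by (rule E.bessel[OF that(2,3)])
    also have "\<dots> \<le> B' * B"
      using F.norm_frame_sq_le[OF that(1)] E.upper_pos by (intro mult_left_mono) auto
    finally show ?thesis by (simp add: mult.commute)
  qed
  have cross_col: "(\<Sum>i\<in>F. (norm (ip (f i) (e k)))\<^sup>2) \<le> B * B'"
    if "k \<in> G" "finite F" "F \<subseteq> I" for k F
  proof -
    have "(\<Sum>i\<in>F. (norm (ip (f i) (e k)))\<^sup>2) \<le> B * (norm (e k))\<^sup>2"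
      using F.bessel[OF that(2,3)] by (simp add: F.norm_ip_commute[of _ "e k"])
    also have "\<dots> \<le> B * B'"
      using E.norm_frame_sq_le[OF that(1)] F.upper_pos by (intro mult_left_mono) auto
    finally show ?thesis .
  qed
  show ?thesis
  proof (rule that[OF K])
    fix P P' Q Q' and \<epsilon> :: real
    assume P: "finite P" "P \<subseteq> I" "P' \<subseteq> P" and Q: "finite Q" "Q \<subseteq> G" "Q' \<subseteq> Q" and \<epsilon>: "0 \<le> \<epsilon>"
      and row: "\<And>i F. i \<in> P' \<Longrightarrow> finite F \<Longrightarrow> F \<subseteq> G - Q \<Longrightarrow>
        (\<Sum>k\<in>F. (norm (ip (f i) (e k)))\<^sup>2) \<le> \<epsilon>"
      and col: "\<And>k F. k \<in> Q' \<Longrightarrow> finite F \<Longrightarrow> F \<subseteq> I - P \<Longrightarrow>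
        (\<Sum>i\<in>F. (norm (ip (f i) (e k)))\<^sup>2) \<le> \<epsilon>"
    \<comment> \<open>What row \<open>i\<close> and column \<open>k\<close> of \<open>T\<close> have outside the block \<open>P \<times> Q\<close>.\<close>
    define r where "r i = of_real (F.leverage i) - (\<Sum>k\<in>Q. T i k)" for i
    define s where "s k = of_real (E.leverage k) - (\<Sum>i\<in>P. T i k)" for k
    have r_sum: "((\<lambda>k. T i k) has_sum r i) (G - Q)" for i
      unfolding r_def using Q by (intro has_sum_Diff row_sum) auto
    have s_sum: "((\<lambda>i. T i k) has_sum s k) (I - P)" for k
      unfolding s_def using P by (intro has_sum_Diff col_sum) auto
    have scale: "sqrt \<epsilon> * sqrt C \<le> K * sqrt \<epsilon>"
      using \<epsilon> mult_right_mono[of "sqrt C" K "sqrt \<epsilon>"] by (simp add: K_def mult.commute)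
    have r_bound: "norm (sum r P) \<le> K * (sqrt \<epsilon> * real (card P) + real (card (P - P')))"
    proof (intro norm_sum_le_core_shell K)
      fix i assume "i \<in> P'"
      with P have "norm (r i) \<le> sqrt \<epsilon> * sqrt C"
        by (intro norm_has_sum_mult_le_sqrt[OF r_sum[unfolded T_def]] row dual_row) auto
      with scale show "norm (r i) \<le> K * sqrt \<epsilon>" by linarith
    next
      fix i assume "i \<in> P - P'"
      with P have "norm (r i) \<le> sqrt (B * B') * sqrt C"
        by (intro norm_has_sum_mult_le_sqrt[OF r_sum[unfolded T_def]] cross_row dual_row) auto
      then show "norm (r i) \<le> K" by (simp add: K_def)
    qed (use P \<epsilon> in auto)
    have s_bound: "norm (sum s Q) \<le> K * (sqrt \<epsilon> * real (card Q) + real (card (Q - Q')))"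
    proof (intro norm_sum_le_core_shell K)
      fix k assume "k \<in> Q'"
      with Q have "norm (s k) \<le> sqrt \<epsilon> * sqrt C"
        by (intro norm_has_sum_mult_le_sqrt[OF s_sum[unfolded T_def]] col dual_col) auto
      with scale show "norm (s k) \<le> K * sqrt \<epsilon>" by linarith
    next
      fix k assume "k \<in> Q - Q'"
      with Q have "norm (s k) \<le> sqrt (B * B') * sqrt C"
        by (intro norm_has_sum_mult_le_sqrt[OF s_sum[unfolded T_def]] cross_col dual_col) auto
      then show "norm (s k) \<le> K" by (simp add: K_def)
    qed (use Q \<epsilon> in auto)
    have "of_real (sum F.leverage P - sum E.leverage Q) = sum r P - sum s Q"
      using sum.swap[of T Q P] by (simp add: r_def s_def sum_subtractf)
    then have "\<bar>sum F.leverage P - sum E.leverage Q\<bar> = norm (sum r P - sum s Q)"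
      by (metis norm_of_real)
    also have "\<dots> \<le> norm (sum r P) + norm (sum s Q)" by (rule norm_triangle_ineq4)
    also note add_mono[OF r_bound s_bound]
    finally show "\<bar>sum F.leverage P - sum E.leverage Q\<bar>
        \<le> K * (sqrt \<epsilon> * real (card P) + real (card (P - P')))
          + K * (sqrt \<epsilon> * real (card Q) + real (card (Q - Q')))" .
  qed
qed

end

section \<open>Removing infinitely many elements\<close>

text \<open>
  Elements are chosen one after the other. If the columns of \<open>g\<close> tend to 0, all but finitely many
  candidates have an entry as small as desired with each of the finitely many elements chosen so
  far. The product form \<open>w i * w k\<close> is chosen because the matrix with these entries has norm
  \<open>\<Sum> w\<^sup>2\<close>.
\<close>

lemma sparse_infinite_subset:
  fixes g :: "'i \<Rightarrow> 'i \<Rightarrow> real"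
  assumes K: "infinite K" and sym: "\<And>i k. g i k = g k i" and "\<eta> > 0"
    and fin: "\<And>k \<tau>. k \<in> K \<Longrightarrow> \<tau> > 0 \<Longrightarrow> finite {i \<in> K. g i k > \<tau>}"
  obtains J w where "J \<subseteq> K" "infinite J" "\<And>i. 0 \<le> w i"
    "\<And>F. finite F \<Longrightarrow> F \<subseteq> J \<Longrightarrow> (\<Sum>i\<in>F. (w i)\<^sup>2) \<le> 1"
    "\<And>i k. i \<in> J \<Longrightarrow> k \<in> J \<Longrightarrow> i \<noteq> k \<Longrightarrow> g i k \<le> \<eta> * (w i * w k)"
proof -
  define v where "v n = (1 / 2 :: real) ^ Suc n" for n
  have v_pos: "0 < v n" and v_le: "v n \<le> 1" for n by (simp_all add: v_def power_le_one del: power_Suc)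
  have "\<exists>s. \<forall>m. s m \<in> K \<and> s m \<notin> s ` {..<m} \<and> (\<forall>n<m. g (s m) (s n) \<le> \<eta> * (v m)\<^sup>2)"
  proof (rule dependent_wellorder_choice)
    fix m :: nat and s :: "nat \<Rightarrow> 'i"
    assume s: "\<And>n. n < m \<Longrightarrow> s n \<in> K \<and> s n \<notin> s ` {..<n} \<and> (\<forall>l<n. g (s n) (s l) \<le> \<eta> * (v n)\<^sup>2)"
    have "0 < \<eta> * (v m)\<^sup>2" using \<open>\<eta> > 0\<close> v_pos[of m] by simp
    then have "finite (\<Union>n<m. {i \<in> K. g i (s n) > \<eta> * (v m)\<^sup>2})"
      using s fin by blast
    then have "infinite (K - (s ` {..<m} \<union> (\<Union>n<m. {i \<in> K. g i (s n) > \<eta> * (v m)\<^sup>2})))"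
      using K by (intro Diff_infinite_finite) auto
    then obtain i where "i \<in> K - (s ` {..<m} \<union> (\<Union>n<m. {i \<in> K. g i (s n) > \<eta> * (v m)\<^sup>2}))"
      using infinite_imp_nonempty by blast
    then show "\<exists>i. i \<in> K \<and> i \<notin> s ` {..<m} \<and> (\<forall>n<m. g i (s n) \<le> \<eta> * (v m)\<^sup>2)"
      by (intro exI[of _ i]) (auto simp: not_less)
  next
    fix i :: 'i and s t :: "nat \<Rightarrow> 'i" and m
    assume "\<And>n. n < m \<Longrightarrow> s n = t n"
    then show "(i \<in> K \<and> i \<notin> s ` {..<m} \<and> (\<forall>n<m. g i (s n) \<le> \<eta> * (v m)\<^sup>2))
      = (i \<in> K \<and> i \<notin> t ` {..<m} \<and> (\<forall>n<m. g i (t n) \<le> \<eta> * (v m)\<^sup>2))"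
      by (auto simp: image_def)
  qed
  then obtain s where s_all: "\<And>m. s m \<in> K \<and> s m \<notin> s ` {..<m} \<and>
      (\<forall>n<m. g (s m) (s n) \<le> \<eta> * (v m)\<^sup>2)" by blast
  have s: "s m \<in> K" "n < m \<Longrightarrow> s n \<noteq> s m"
      "n < m \<Longrightarrow> g (s m) (s n) \<le> \<eta> * (v m)\<^sup>2" for m n
    using s_all[of m] imageI[of n "{..<m}" s] lessThan_iff by metis+
  have inj: "inj s" using s(2) by (intro linorder_injI) auto
  define w where "w i = v (the_inv s i)" for i
  have w: "w (s n) = v n" for n by (simp add: w_def the_inv_f_f[OF inj])
  have far: "g (s m) (s n) \<le> \<eta> * (w (s m) * w (s n))" if "n < m" for m n
  proof -
    have "v m \<le> v n" unfolding v_def using that by (intro power_decreasing) auto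
    \<comment> \<open>The later element has the smaller weight, so the square of its weight was the right threshold.\<close>
    then have "\<eta> * (v m)\<^sup>2 \<le> \<eta> * (v m * v n)"
      unfolding power2_eq_square using \<open>\<eta> > 0\<close> v_pos[of m] by (intro mult_left_mono) auto
    with s(3)[OF that] show ?thesis by (simp add: w)
  qed
  show ?thesis
  proof (rule that[of "range s" w])
    show "range s \<subseteq> K" using s(1) by auto
    show "infinite (range s)" using inj by (rule range_inj_infinite)
    show "0 \<le> w i" for i using less_imp_le[OF v_pos] by (simp add: w_def)
    show "(\<Sum>i\<in>F. (w i)\<^sup>2) \<le> 1" if F: "finite F" "F \<subseteq> range s" for F
    proof -
      obtain N where N: "F = s ` N" "finite N"
        using F by (metis finite_subset_image subset_UNIV)
      have "(\<Sum>i\<in>F. (w i)\<^sup>2) = (\<Sum>n\<in>N. (v n)\<^sup>2)"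
        unfolding N(1) using inj by (subst sum.reindex) (auto simp: w intro: inj_on_subset)
      also have "\<dots> \<le> (\<Sum>n\<in>N. v n)"
        using v_le v_pos by (intro sum_mono) (simp add: power2_eq_square mult_left_le less_imp_le)
      also have "\<dots> \<le> 1"
        unfolding v_def using power_half_series N(2)
        by (intro sum_le_suminf[THEN order.trans]) (auto simp: sums_iff)
      finally show ?thesis .
    qed
    show "g i k \<le> \<eta> * (w i * w k)" if "i \<in> range s" "k \<in> range s" "i \<noteq> k" for i k
    proof -
      from that obtain m n where mn: "i = s m" "k = s n" "m \<noteq> n" by auto
      then consider "m < n" | "n < m" by linarith
      then show ?thesis
        using far[of m n] far[of n m] sym[of i k] by cases (simp_all add: mn mult.commute)
    qed
  qed
qed

context framed
begin

text \<open>
  Chebyshev's inequality for the counting measure.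
\<close>

lemma finite_large_coefficients:
  assumes "\<tau> > 0"
  shows "finite {i \<in> I. norm (ip h (f i)) > \<tau>}"
proof (rule finite_if_finite_subsets_card_bdd[of _ "nat \<lfloor>energy h / \<tau>\<^sup>2\<rfloor>", THEN conjunct1])
  fix F assume F: "F \<subseteq> {i \<in> I. norm (ip h (f i)) > \<tau>}" "finite F"
  have "real (card F) * \<tau>\<^sup>2 = (\<Sum>i\<in>F. \<tau>\<^sup>2)" by simp
  also have "\<dots> \<le> (\<Sum>i\<in>F. (norm (ip h (f i)))\<^sup>2)"
    using F assms by (intro sum_mono power_mono) auto
  also have "\<dots> \<le> energy h" using F by (intro finite_energy_le) auto
  finally have "real (card F) \<le> energy h / \<tau>\<^sup>2" using assms by (simp add: field_simps)
  then show "card F \<le> nat \<lfloor>energy h / \<tau>\<^sup>2\<rfloor>" by (simp add: le_nat_floor)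
qed

text \<open>
  The left-hand side is the quadratic form of the Gram matrix \<open>\<langle>f\<^sub>k, S\<^sup>-\<^sup>1 f\<^sub>i\<rangle>\<close> at \<open>c\<close>. Its diagonal consists
  of leverages and contributes at most \<open>\<mu> \<Sum> |c\<^sub>i|\<^sup>2\<close>, and the off-diagonal part is dominated by the
  rank-one matrix \<open>\<eta> w\<^sub>i w\<^sub>k\<close>.
\<close>

lemma energy_Sinv_synthesis_le:
  assumes F: "finite F" "F \<subseteq> I" and \<eta>: "0 \<le> \<eta>"
    and diag: "\<And>i. i \<in> F \<Longrightarrow> leverage i \<le> \<mu>"
    and off: "\<And>i k. i \<in> F \<Longrightarrow> k \<in> F \<Longrightarrow> i \<noteq> k \<Longrightarrow> norm (ip (f i) (dual k)) \<le> \<eta> * (w i * w k)"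
    and w: "\<And>i. 0 \<le> w i" "(\<Sum>i\<in>F. (w i)\<^sup>2) \<le> 1"
  shows "energy (Sinv (\<Sum>i\<in>F. smul (c i) (f i))) \<le> (\<mu> + \<eta>) * (\<Sum>i\<in>F. (norm (c i))\<^sup>2)"
proof -
  define v where "v = (\<Sum>i\<in>F. smul (c i) (f i))"
  have "energy (Sinv v) = norm (ip (S (Sinv v)) (Sinv v))"
    unfolding ip_S_self norm_of_real using energy_nonneg by simp
  also have "ip (S (Sinv v)) (Sinv v) = (\<Sum>i\<in>F. c i * ip (f i) (Sinv v))"
    unfolding S_Sinv by (simp add: v_def ip_sum_left ip_smul_left)
  also have "\<dots> = (\<Sum>i\<in>F. \<Sum>k\<in>F. c i * conjug (c k * ip (f k) (dual i)))"
  proof (intro sum.cong refl)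
    fix i
    have "ip (f i) (Sinv v) = conjug (ip v (dual i))"
      by (simp add: ip_Sinv_commute[symmetric] dual_eq[symmetric] ip_commute[symmetric])
    also have "ip v (dual i) = (\<Sum>k\<in>F. c k * ip (f k) (dual i))"
      by (simp add: v_def ip_sum_left ip_smul_left)
    also have "conjug \<dots> = (\<Sum>k\<in>F. conjug (c k * ip (f k) (dual i)))"
      by (rule linear_sum[OF bounded_linear.linear[OF bounded_linear_conjug]])
    finally show "c i * ip (f i) (Sinv v) = (\<Sum>k\<in>F. c i * conjug (c k * ip (f k) (dual i)))"
      by (simp add: sum_distrib_left)
  qed
  also have "norm \<dots> \<le> (\<Sum>i\<in>F. \<Sum>k\<in>F. (if i = k then \<mu> * (norm (c i))\<^sup>2 else 0)
      + \<eta> * ((norm (c i) * w i) * (norm (c k) * w k)))"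
  proof (intro sum_norm_le)
    fix i k assume ik: "i \<in> F" "k \<in> F"
    show "norm (c i * conjug (c k * ip (f k) (dual i)))
      \<le> (if i = k then \<mu> * (norm (c i))\<^sup>2 else 0) + \<eta> * ((norm (c i) * w i) * (norm (c k) * w k))"
    proof (cases "i = k")
      case True
      have "norm (c i * conjug (c k * ip (f k) (dual i))) = leverage i * (norm (c i))\<^sup>2"
        using True leverage_nonneg[of i]
        by (simp add: norm_mult ip_frame_dual power2_eq_square)
      also have "\<dots> \<le> \<mu> * (norm (c i))\<^sup>2" using diag ik by (intro mult_right_mono) auto
      finally show ?thesis using True \<eta> w(1) by (simp add: add_increasing2)
    next
      case False
      have "norm (c i * conjug (c k * ip (f k) (dual i)))
        = norm (c i) * norm (c k) * norm (ip (f k) (dual i))" by (simp add: norm_mult)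
      also have "\<dots> \<le> norm (c i) * norm (c k) * (\<eta> * (w k * w i))"
        using False ik by (intro mult_left_mono off) auto
      finally show ?thesis using False by (simp add: ac_simps)
    qed
  qed
  also have "\<dots> = \<mu> * (\<Sum>i\<in>F. (norm (c i))\<^sup>2) + \<eta> * (\<Sum>i\<in>F. norm (c i) * w i)\<^sup>2"
    using F(1) by (simp add: sum.distrib sum_distrib_left[symmetric] power2_eq_square
        sum_product[symmetric] sum_distrib_right[symmetric])
  also have "(\<Sum>i\<in>F. norm (c i) * w i)\<^sup>2 \<le> (\<Sum>i\<in>F. (norm (c i))\<^sup>2) * (\<Sum>i\<in>F. (w i)\<^sup>2)"
    by (rule Cauchy_Schwarz_ineq_sum)
  also have "\<dots> \<le> (\<Sum>i\<in>F. (norm (c i))\<^sup>2) * 1"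
    by (intro mult_left_mono w sum_nonneg) auto
  finally have "energy (Sinv v) \<le> \<mu> * (\<Sum>i\<in>F. (norm (c i))\<^sup>2) + \<eta> * ((\<Sum>i\<in>F. (norm (c i))\<^sup>2) * 1)"
    using \<eta> by (simp add: mult_left_mono)
  then show ?thesis by (simp add: v_def algebra_simps)
qed

text \<open>
  Put \<open>v = \<Sum>\<^sub>i\<^sub>\<in>\<^sub>F \<langle>h, f\<^sub>i\<rangle> f\<^sub>i\<close> for a finite set \<open>F\<close> of removed indices, and let \<open>s\<close> be the energy of \<open>h\<close> that they carry.
  Then \<open>s = \<langle>v, h\<rangle>\<close>, and by Cauchy--Schwarz \<open>s\<^sup>2\<close> is at most the energy of \<open>h\<close> times that of \<open>S\<^sup>-\<^sup>1 v\<close>, which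
  the Gram matrix bounds by \<open>(1 - \<delta> / 2) s\<close>. So a fraction \<open>\<delta> / 2\<close> of the energy survives the removal.
\<close>

lemma remove_infinite_subset:
  assumes K: "K \<subseteq> I" "infinite K" and "\<delta> > 0"
    and leverage_K: "\<And>i. i \<in> K \<Longrightarrow> leverage i \<le> 1 - \<delta>"
  shows "\<exists>J\<subseteq>I. infinite J \<and> is_frame ip (I - J) f"
proof -
  define \<eta> where "\<eta> = \<delta> / 2"
  have \<eta>: "0 < \<eta>" using \<open>\<delta> > 0\<close> by (simp add: \<eta>_def)
  have \<eta>_le: "\<eta> \<le> 1"
  proof -
    obtain i where "i \<in> K" using K(2) infinite_imp_nonempty by blast
    then have "0 \<le> 1 - \<delta>" using leverage_K leverage_nonneg order.trans by blast
    with \<open>\<delta> > 0\<close> show ?thesis by (simp add: \<eta>_def)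
  qed
  have sym: "norm (ip (f i) (dual k)) = norm (ip (f k) (dual i))" for i k
    by (metis dual_eq ip_Sinv_commute norm_ip_commute)
  have fin: "finite {i \<in> K. norm (ip (f i) (dual k)) > \<tau>}" if "\<tau> > 0" for k \<tau>
    by (rule finite_subset[OF _ finite_large_coefficients[OF that, of "dual k"]])
       (use K(1) in \<open>auto simp: norm_ip_commute[of _ "dual k"]\<close>)
  obtain J w where J: "J \<subseteq> K" "infinite J" and w: "\<And>i. 0 \<le> w i"
      "\<And>F. finite F \<Longrightarrow> F \<subseteq> J \<Longrightarrow> (\<Sum>i\<in>F. (w i)\<^sup>2) \<le> 1"
      and off: "\<And>i k. i \<in> J \<Longrightarrow> k \<in> J \<Longrightarrow> i \<noteq> k \<Longrightarrow> norm (ip (f i) (dual k)) \<le> \<eta> * (w i * w k)"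
    using sparse_infinite_subset[OF K(2) sym \<eta> fin] by metis
  have J_sub: "J \<subseteq> I" using J K by simp
  have J_energy: "(\<Sum>\<^sub>\<infinity>i\<in>J. (norm (ip h (f i)))\<^sup>2) \<le> (1 - \<eta>) * energy h" for h
  proof (rule infsum_le_finite_sums)
    show "(\<lambda>i. (norm (ip h (f i)))\<^sup>2) summable_on J"
      using coeff_summable J_sub by (rule summable_on_subset_banach)
    fix F assume F: "finite F" "F \<subseteq> J"
    define v where "v = (\<Sum>i\<in>F. smul (ip h (f i)) (f i))"
    define s where "s = (\<Sum>i\<in>F. (norm (ip h (f i)))\<^sup>2)"
    have s: "0 \<le> s" by (simp add: s_def sum_nonneg)
    have "energy (Sinv v) \<le> ((1 - \<delta>) + \<eta>) * s"
      unfolding v_def s_def using F J J_sub leverage_K off w \<eta>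
      by (intro energy_Sinv_synthesis_le[where w = w]) (auto simp: subset_iff)
    then have energy_v: "energy (Sinv v) \<le> (1 - \<eta>) * s" by (simp add: \<eta>_def)
    have "ip (S (Sinv v)) h = of_real s"
      unfolding S_Sinv by (simp only: v_def s_def ip_sum_left ip_smul_left ip_mult_flip of_real_sum)
    then have "s * s = (norm (ip (S (Sinv v)) h))\<^sup>2"
      by (simp add: power2_eq_square)
    also have "\<dots> \<le> energy (Sinv v) * energy h" by (rule norm_ip_S_sq_le)
    also have "\<dots> \<le> (1 - \<eta>) * s * energy h"
      by (intro mult_right_mono energy_v energy_nonneg)
    finally have "s * s \<le> (1 - \<eta>) * energy h * s" by (simp add: ac_simps)
    then show "s \<le> (1 - \<eta>) * energy h"
      by (rule le_if_square_le) (use s \<eta>_le energy_nonneg in simp_all)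
  qed
  have summable: "(\<lambda>i. (norm (ip h (f i)))\<^sup>2) summable_on I - J" for h
    using coeff_summable by (rule summable_on_subset_banach) auto
  have split: "(\<Sum>\<^sub>\<infinity>i\<in>I - J. (norm (ip h (f i)))\<^sup>2)
      = energy h - (\<Sum>\<^sub>\<infinity>i\<in>J. (norm (ip h (f i)))\<^sup>2)" for h
    unfolding energy_def using coeff_summable J_sub
    by (intro infsum_Diff) (auto intro: summable_on_subset_banach)
  have lower: "\<eta> * A * (norm h)\<^sup>2 \<le> (\<Sum>\<^sub>\<infinity>i\<in>I - J. (norm (ip h (f i)))\<^sup>2)" for h
  proof -
    have "\<eta> * (A * (norm h)\<^sup>2) \<le> \<eta> * energy h"
      using \<eta> lower_energy by (intro mult_left_mono) auto
    with J_energy[of h] show ?thesis unfolding split by (simp add: algebra_simps)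
  qed
  have upper: "(\<Sum>\<^sub>\<infinity>i\<in>I - J. (norm (ip h (f i)))\<^sup>2) \<le> B * (norm h)\<^sup>2" for h
  proof -
    have "0 \<le> (\<Sum>\<^sub>\<infinity>i\<in>J. (norm (ip h (f i)))\<^sup>2)" by (rule infsum_nonneg) simp
    with upper_energy[of h] show ?thesis unfolding split by linarith
  qed
  have "0 < \<eta> * A" using \<eta> lower_pos by simp
  with summable lower upper upper_pos have "is_frame ip (I - J) f"
    unfolding is_frame_def by blast
  with J J_sub show ?thesis by blast
qed

end

section \<open>Riesz bases\<close>

text \<open>
  Compare \<open>h\<close> with its orthogonal projection \<open>p\<close> onto the span of the finitely many vectors.
\<close>

lemma (in hilbert_space) orthonormal_bessel:
  assumes F: "finite F" and orth: "\<And>i k. i \<in> F \<Longrightarrow> k \<in> F \<Longrightarrow> ip (b i) (b k) = (if i = k then 1 else 0)"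
  shows "(\<Sum>i\<in>F. (norm (ip h (b i)))\<^sup>2) \<le> (norm h)\<^sup>2"
proof -
  define p where "p = (\<Sum>i\<in>F. smul (ip h (b i)) (b i))"
  define s where "s = (\<Sum>i\<in>F. (norm (ip h (b i)))\<^sup>2)"
  have p_h: "ip p h = of_real s"
    by (simp only: p_def s_def ip_sum_left ip_smul_left ip_mult_flip of_real_sum)
  have p_b: "ip p (b i) = ip h (b i)" if "i \<in> F" for i
    using F that by (simp add: p_def ip_sum_left ip_smul_left orth if_distrib cong: if_cong)
  have "ip p p = (\<Sum>i\<in>F. ip h (b i) * ip (b i) p)"
    by (subst p_def) (simp only: ip_sum_left ip_smul_left)
  also have "\<dots> = of_real s"
    unfolding s_def of_real_sum
  proof (intro sum.cong refl)
    fix i assume "i \<in> F"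
    then have "ip (b i) p = ip (b i) h" by (subst (1 2) ip_commute) (simp only: p_b)
    then show "ip h (b i) * ip (b i) p = of_real ((norm (ip h (b i)))\<^sup>2)"
      by (simp only: ip_mult_flip)
  qed
  finally have "(norm p)\<^sup>2 = s" by (simp only: ip_self of_real_eq_iff)
  moreover have "re_part (ip h p) = s" by (simp only: ip_commute[of h] p_h re_part_conjug re_part_of_real)
  ultimately have "0 \<le> (norm h)\<^sup>2 - s" using norm_diff_sq[of h p] zero_le_power2[of "norm (h - p)"] by simp
  then show ?thesis by (simp add: s_def)
qed

text \<open>
  Frame expansions in a Riesz basis have unique coefficients: \<open>f\<^sub>i = \<Sum>\<^sub>k c\<^sub>k f\<^sub>k\<close> is the image under \<open>T\<close> of
  \<open>\<Sum>\<^sub>k c\<^sub>k b\<^sub>k\<close>, which must therefore be \<open>b\<^sub>i\<close>. So the coefficient \<open>c\<^sub>i\<close>, which is the leverage, equals 1.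
\<close>

lemma (in framed) riesz_basis_leverage:
  assumes "riesz_basis smul ip I f" and i: "i \<in> I"
  shows "leverage i = 1"
proof -
  obtain b T where orth: "\<And>i k. i \<in> I \<Longrightarrow> k \<in> I \<Longrightarrow> ip (b i) (b k) = (if i = k then 1 else 0)"
    and lin: "Vector_Spaces.linear smul smul T" and cont: "continuous_on UNIV T"
    and bij: "bij T" and f: "\<And>i. i \<in> I \<Longrightarrow> f i = T (b i)"
    using assms(1) unfolding riesz_basis_def orthonormal_basis_def by blast
  define c where "c k = ip (f i) (dual k)" for k
  have "(\<lambda>k. (norm (c k))\<^sup>2) summable_on I"
    unfolding c_def using coeff_summable[of "Sinv (f i)"] by (simp add: ip_Sinv_frame)
  then have "(\<lambda>k. smul (c k) (b k)) summable_on I"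
    using orthonormal_bessel[of _ b] orth by (intro synthesis_summable_on[where B = 1]) (auto simp: subset_iff)
  then obtain x where x: "((\<lambda>k. smul (c k) (b k)) has_sum x) I" by (auto simp: summable_on_def)
  have "(T \<circ> (\<lambda>k. smul (c k) (b k)) has_sum T x) I"
  proof (rule has_sum_comm_additive[OF _ _ x])
    show "Modules.additive T"
      by unfold_locales (rule module_hom.add[OF lin[unfolded linear_iff_module_hom]])
    show "T \<midarrow>x\<rightarrow> T x" using cont by (simp add: continuous_on_eq_continuous_at isCont_def)
  qed
  moreover have "((\<lambda>k. smul (c k) (f k)) has_sum f i) I"
    unfolding c_def by (rule dual_expansion)
  then have "(T \<circ> (\<lambda>k. smul (c k) (b k)) has_sum f i) I"
    by (rule has_sum_cong[THEN iffD1, rotated])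
       (simp add: f module_hom.scale[OF lin[unfolded linear_iff_module_hom]])
  ultimately have "T x = T (b i)" using has_sum_unique f[OF i] by metis
  then have x_eq: "x = b i" using bij by (simp add: bij_is_inj inj_eq)
  have "((\<lambda>k. c k * ip (b k) (b i)) has_sum ip x (b i)) I"
    using has_sum_ip[OF x] by (simp add: ip_smul_left)
  moreover have "((\<lambda>k. c k * ip (b k) (b i)) has_sum c i) I"
  proof -
    have "((\<lambda>k. c k * ip (b k) (b i)) has_sum (\<Sum>k\<in>{i}. c k * ip (b k) (b i))) I"
      by (rule has_sum_finite_neutralI[where B = "{i}"]) (use i orth in auto)
    then show ?thesis using orth i by simp
  qed
  ultimately have "c i = 1" using has_sum_unique x_eq orth i by fastforce
  then have "of_real (leverage i) = (of_real 1 :: 'k)" by (simp add: c_def ip_frame_dual)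
  then show ?thesis by (simp only: of_real_eq_iff)
qed

section \<open>Boxes in the reference group\<close>

lemma PiE_times_PiE_Collect:
  "{g \<in> PiE {..<d} A \<times> PiE {..<e} B. (\<forall>i<d. P i (fst g i)) \<and> (\<forall>j<e. Q j (snd g j))}
    = (\<Pi>\<^sub>E i\<in>{..<d::nat}. {x \<in> A i. P i x}) \<times> (\<Pi>\<^sub>E j\<in>{..<e::nat}. {m \<in> B j. Q j m})"
  by (auto simp: PiE_iff)

locale reference_group =
  fixes \<alpha>s :: "real list" and ns :: "nat list"
  assumes finite_factors: "\<forall>n\<in>set ns. n > 0"
    and infinite_G: "infinite (carrier (refgroup \<alpha>s ns))"
begin

abbreviation G :: "refelem monoid" where "G \<equiv> refgroup \<alpha>s ns"
abbreviation Sbox :: "nat \<Rightarrow> refelem \<Rightarrow> refelem set" where "Sbox \<equiv> S_box \<alpha>s ns"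

sublocale G: group G by (rule group_refgroup)

lemma carrier_G: "carrier G =
    (\<Pi>\<^sub>E i\<in>{..<length \<alpha>s}. range (\<lambda>k::int. \<alpha>s ! i * of_int k)) \<times> (\<Pi>\<^sub>E j\<in>{..<length ns}. {0..<int (ns ! j)})"
proof -
  have "(\<Pi>\<^sub>E j\<in>{..<length ns}. carrier (integer_mod_group (ns ! j)))
      = (\<Pi>\<^sub>E j\<in>{..<length ns}. {0..<int (ns ! j)})"
    using finite_factors by (intro PiE_cong) (auto simp: carrier_integer_mod_group dest: nth_mem)
  then show ?thesis by (simp add: refgroup_def DirProd_def scaled_integers_def)
qed

text \<open>
  This ensures that the supremum defining the norm is taken over a nonempty set.
\<close>

lemma nonempty_\<alpha>s: "\<alpha>s \<noteq> []"
proof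
  assume "\<alpha>s = []"
  then have "finite (carrier G)" unfolding carrier_G by (auto intro!: finite_PiE)
  with infinite_G show False by simp
qed

lemma refnorm_le_iff:
  "refnorm \<alpha>s ns g \<le> c \<longleftrightarrow> (\<forall>i<length \<alpha>s. \<bar>fst g i\<bar> \<le> c) \<and>
     (\<forall>j<length ns. (if snd g j = 0 then 0 else 1) \<le> c)"
  unfolding refnorm_def using nonempty_\<alpha>s by (subst cSup_le_iff) auto

lemma fst_le_refnorm: "i < length \<alpha>s \<Longrightarrow> \<bar>fst g i\<bar> \<le> refnorm \<alpha>s ns g"
  and snd_le_refnorm: "j < length ns \<Longrightarrow> (if snd g j = 0 then 0 else 1) \<le> refnorm \<alpha>s ns g"
  using refnorm_le_iff[of g "refnorm \<alpha>s ns g"] by blast+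

lemma refnorm_mult_le:
  "refnorm \<alpha>s ns (g \<otimes>\<^bsub>G\<^esub> h) \<le> refnorm \<alpha>s ns g + refnorm \<alpha>s ns h"
  unfolding refnorm_le_iff
proof (intro conjI allI impI)
  fix i assume i: "i < length \<alpha>s"
  have "fst (g \<otimes>\<^bsub>G\<^esub> h) i = fst g i + fst h i"
    using i by (cases g; cases h) (simp add: refgroup_def DirProd_def scaled_integers_def)
  then show "\<bar>fst (g \<otimes>\<^bsub>G\<^esub> h) i\<bar> \<le> refnorm \<alpha>s ns g + refnorm \<alpha>s ns h"
    using fst_le_refnorm[OF i, of g] fst_le_refnorm[OF i, of h] by linarith
next
  fix j assume j: "j < length ns"
  have "snd (g \<otimes>\<^bsub>G\<^esub> h) j = (snd g j + snd h j) mod int (ns ! j)"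
    using j by (cases g; cases h) (simp add: refgroup_def DirProd_def)
  then show "(if snd (g \<otimes>\<^bsub>G\<^esub> h) j = 0 then 0 else 1) \<le> refnorm \<alpha>s ns g + refnorm \<alpha>s ns h"
    using snd_le_refnorm[OF j, of g] snd_le_refnorm[OF j, of h] by (auto split: if_splits)
qed

text \<open>
  Right translations are isometries, so the triangle inequality is subadditivity of the norm.
\<close>

lemma refdist_triangle:
  assumes "g \<in> carrier G" "h \<in> carrier G" "k \<in> carrier G"
  shows "refdist \<alpha>s ns g k \<le> refdist \<alpha>s ns g h + refdist \<alpha>s ns h k"
proof -
  have "g \<otimes>\<^bsub>G\<^esub> inv\<^bsub>G\<^esub> k = (g \<otimes>\<^bsub>G\<^esub> inv\<^bsub>G\<^esub> h) \<otimes>\<^bsub>G\<^esub> (h \<otimes>\<^bsub>G\<^esub> inv\<^bsub>G\<^esub> k)"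
    using assms G.m_assoc[of "inv\<^bsub>G\<^esub> h" h "inv\<^bsub>G\<^esub> k"] by (simp add: G.m_assoc)
  then show ?thesis unfolding refdist_def using refnorm_mult_le by metis
qed

lemma box_subset_carrier: "Sbox N j \<subseteq> carrier G"
  by (auto simp: S_box_def)

lemma box_trans:
  assumes "k \<in> Sbox L h" "h \<in> Sbox (N - L) j" "L \<le> N" "j \<in> carrier G"
  shows "k \<in> Sbox N j"
  using assms refdist_triangle[of k h j]
  by (auto simp: S_box_def of_nat_diff field_simps)

lemma box_mono: "M \<le> N \<Longrightarrow> Sbox M j \<subseteq> Sbox N j"
  unfolding S_box_def by (auto intro: order.trans)

lemma centre_in_box:
  assumes "j \<in> carrier G"
  shows "j \<in> Sbox N j"
proof -
  have "refnorm \<alpha>s ns \<one>\<^bsub>G\<^esub> \<le> real N / 2"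
    unfolding refnorm_le_iff by (auto simp: refgroup_def scaled_integers_def)
  then show ?thesis using assms by (simp add: S_box_def refdist_def)
qed

text \<open>
  Boxes are translates of one another, so their size does not depend on the centre.
\<close>

definition box_size :: "nat \<Rightarrow> nat" where
  "box_size N = card {g \<in> carrier G. refnorm \<alpha>s ns g \<le> real N / 2}"

lemma bij_betw_box:
  assumes "j \<in> carrier G"
  shows "bij_betw (\<lambda>k. k \<otimes>\<^bsub>G\<^esub> inv\<^bsub>G\<^esub> j) (Sbox N j) {g \<in> carrier G. refnorm \<alpha>s ns g \<le> real N / 2}"
  by (rule bij_betwI[where g = "\<lambda>g. g \<otimes>\<^bsub>G\<^esub> j"])
     (use assms in \<open>auto simp: S_box_def refdist_def G.m_assoc\<close>)

lemma card_box: "j \<in> carrier G \<Longrightarrow> card (Sbox N j) = box_size N"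
  unfolding box_size_def by (rule bij_betw_same_card[OF bij_betw_box])

text \<open>
  A box around the neutral element is a product of one-dimensional boxes, one for each cyclic
  factor of the group.
\<close>

definition free_part :: "nat \<Rightarrow> nat \<Rightarrow> real set" where
  "free_part i N = {x \<in> range (\<lambda>k::int. \<alpha>s ! i * of_int k). \<bar>x\<bar> \<le> real N / 2}"

definition torsion_part :: "nat \<Rightarrow> nat \<Rightarrow> int set" where
  "torsion_part j N = {m \<in> {0..<int (ns ! j)}. (if m = 0 then 0 else 1) \<le> real N / 2}"

lemma origin_box_eq_product:
  "{g \<in> carrier G. refnorm \<alpha>s ns g \<le> real N / 2}
    = (\<Pi>\<^sub>E i\<in>{..<length \<alpha>s}. free_part i N) \<times> (\<Pi>\<^sub>E j\<in>{..<length ns}. torsion_part j N)"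
  unfolding carrier_G refnorm_le_iff free_part_def torsion_part_def
  by (rule PiE_times_PiE_Collect)

lemma free_part_eq:
  assumes "\<alpha>s ! i \<noteq> 0"
  shows "free_part i N = (\<lambda>k. \<alpha>s ! i * of_int k) `
    {- \<lfloor>real N / (2 * \<bar>\<alpha>s ! i\<bar>)\<rfloor>..\<lfloor>real N / (2 * \<bar>\<alpha>s ! i\<bar>)\<rfloor>}"
proof -
  have "\<bar>\<alpha>s ! i * of_int k\<bar> \<le> real N / 2 \<longleftrightarrow>
      k \<in> {- \<lfloor>real N / (2 * \<bar>\<alpha>s ! i\<bar>)\<rfloor>..\<lfloor>real N / (2 * \<bar>\<alpha>s ! i\<bar>)\<rfloor>}" for k :: int
  proof -
    have "\<bar>\<alpha>s ! i * of_int k\<bar> \<le> real N / 2 \<longleftrightarrow> of_int \<bar>k\<bar> \<le> real N / (2 * \<bar>\<alpha>s ! i\<bar>)"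
      using assms by (simp add: abs_mult field_simps)
    also have "\<dots> \<longleftrightarrow> \<bar>k\<bar> \<le> \<lfloor>real N / (2 * \<bar>\<alpha>s ! i\<bar>)\<rfloor>" by (rule le_floor_iff[symmetric])
    finally show ?thesis by auto
  qed
  then show ?thesis unfolding free_part_def by blast
qed

lemma finite_free_part: "finite (free_part i N)"
  and card_free_part: "\<alpha>s ! i \<noteq> 0 \<Longrightarrow> real (card (free_part i N)) = 2 * of_int \<lfloor>real N / (2 * \<bar>\<alpha>s ! i\<bar>)\<rfloor> + 1"
proof -
  show "finite (free_part i N)"
  proof (cases "\<alpha>s ! i = 0")
    case True
    then have "free_part i N \<subseteq> {0}" by (auto simp: free_part_def)
    then show ?thesis by (rule finite_subset) simp
  qed (simp add: free_part_eq)
  assume nz: "\<alpha>s ! i \<noteq> 0"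
  have "0 \<le> \<lfloor>real N / (2 * \<bar>\<alpha>s ! i\<bar>)\<rfloor>" by simp
  then show "real (card (free_part i N)) = 2 * of_int \<lfloor>real N / (2 * \<bar>\<alpha>s ! i\<bar>)\<rfloor> + 1"
    unfolding free_part_eq[OF nz] using nz by (subst card_image) (auto simp: inj_on_def)
qed

lemma finite_torsion_part: "finite (torsion_part j N)"
  by (rule finite_subset[of _ "{0..<int (ns ! j)}"]) (auto simp: torsion_part_def)

lemma finite_box:
  assumes "j \<in> carrier G"
  shows "finite (Sbox N j)"
proof -
  have "finite {g \<in> carrier G. refnorm \<alpha>s ns g \<le> real N / 2}"
    unfolding origin_box_eq_product
    by (intro finite_cartesian_product finite_PiE finite_free_part finite_torsion_part) simp_all
  then show ?thesis using bij_betw_finite[OF bij_betw_box[OF assms]] by simp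
qed

lemma box_size_pos: "0 < box_size N"
proof -
  have "\<one>\<^bsub>G\<^esub> \<in> Sbox N \<one>\<^bsub>G\<^esub>" by (rule centre_in_box) simp
  then show ?thesis
    using finite_box[of "\<one>\<^bsub>G\<^esub>" N] card_box[of "\<one>\<^bsub>G\<^esub>" N] by (metis G.one_closed card_gt_0_iff empty_iff)
qed

lemma box_size_eq_prod:
  "box_size N = (\<Prod>i<length \<alpha>s. card (free_part i N)) * (\<Prod>j<length ns. card (torsion_part j N))"
  unfolding box_size_def origin_box_eq_product by (simp add: card_cartesian_product card_PiE)

text \<open>
  A factor with \<open>\<alpha>\<^sub>i = 0\<close> is trivial. Otherwise the box is a symmetric interval of integers whose
  length grows linearly in \<open>N\<close>.
\<close>

lemma free_part_ratio_tendsto: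
  "(\<lambda>N. real (card (free_part i N)) / real (card (free_part i (N + L)))) \<longlonglongrightarrow> 1"
proof (cases "\<alpha>s ! i = 0")
  case True
  then have "free_part i N = {0}" for N by (auto simp: free_part_def)
  then show ?thesis by simp
next
  case False
  define \<beta> where "\<beta> = 1 / (2 * \<bar>\<alpha>s ! i\<bar>)"
  have \<beta>: "\<beta> > 0" using False by (simp add: \<beta>_def)
  have card: "real (card (free_part i N)) = 2 * of_int \<lfloor>real N * \<beta>\<rfloor> + 1" for N
    using card_free_part[OF False, of N] by (simp add: \<beta>_def)
  have pos: "0 \<le> \<lfloor>real N * \<beta>\<rfloor>" for N using \<beta> by simp
  show ?thesis
  proof (rule tendsto_sandwich)
    show "(\<lambda>N. (2 * (real N * \<beta>) - 1) / (2 * (real (N + L) * \<beta>) + 1)) \<longlonglongrightarrow> 1"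
      using \<beta> unfolding of_nat_add by real_asymp
    show "(\<lambda>_. 1 :: real) \<longlonglongrightarrow> 1" by simp
    show "\<forall>\<^sub>F N in sequentially. (2 * (real N * \<beta>) - 1) / (2 * (real (N + L) * \<beta>) + 1)
        \<le> real (card (free_part i N)) / real (card (free_part i (N + L)))"
    proof (intro always_eventually allI frac_le)
      fix N
      show "0 \<le> real (card (free_part i N))" by simp
      show "2 * (real N * \<beta>) - 1 \<le> real (card (free_part i N))"
        unfolding card by linarith
      show "0 < real (card (free_part i (N + L)))"
        unfolding card using pos[of "N + L"] by linarith
      show "real (card (free_part i (N + L))) \<le> 2 * (real (N + L) * \<beta>) + 1"
        unfolding card by linarith
    qed
    show "\<forall>\<^sub>F N in sequentially. real (card (free_part i N)) / real (card (free_part i (N + L))) \<le> 1"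
    proof (intro always_eventually allI)
      fix N
      have "\<lfloor>real N * \<beta>\<rfloor> \<le> \<lfloor>real (N + L) * \<beta>\<rfloor>"
        using \<beta> by (intro floor_mono mult_right_mono) auto
      then show "real (card (free_part i N)) / real (card (free_part i (N + L))) \<le> 1"
        unfolding card using pos[of "N + L"] by (intro divide_le_eq_1_pos[THEN iffD2]) linarith+
    qed
  qed
qed

lemma torsion_part_ratio_tendsto:
  assumes "j < length ns"
  shows "(\<lambda>N. real (card (torsion_part j N)) / real (card (torsion_part j (N + L)))) \<longlonglongrightarrow> 1"
proof (rule tendsto_eventually)
  have full: "torsion_part j N = {0..<int (ns ! j)}" if "N \<ge> 2" for N
    using that unfolding torsion_part_def by auto
  have "ns ! j > 0" using finite_factors assms by simp
  then show "\<forall>\<^sub>F N in sequentially. real (card (torsion_part j N)) / real (card (torsion_part j (N + L))) = 1"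
    by (intro eventually_mono[OF eventually_ge_at_top[of 2]]) (simp add: full)
qed

lemma box_size_ratio_tendsto: "(\<lambda>N. real (box_size N) / real (box_size (N + L))) \<longlonglongrightarrow> 1"
proof -
  have "(\<lambda>N. (\<Prod>i<length \<alpha>s. real (card (free_part i N)) / real (card (free_part i (N + L)))) *
      (\<Prod>j<length ns. real (card (torsion_part j N)) / real (card (torsion_part j (N + L)))))
    \<longlonglongrightarrow> (\<Prod>i<length \<alpha>s. 1) * (\<Prod>j<length ns. 1)"
    by (intro tendsto_mult tendsto_prod free_part_ratio_tendsto torsion_part_ratio_tendsto) simp
  then show ?thesis by (simp add: box_size_eq_prod prod_dividef)
qed

text \<open>
  The group is amenable with the boxes as a Folner sequence: enlarging a large box by a fixed
  amount changes its size by a factor close to 1.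
\<close>

lemma card_shell_small:
  assumes "\<epsilon> > 0"
  shows "\<forall>\<^sub>F N in sequentially. L \<le> N \<and>
    (\<forall>j\<in>carrier G. real (card (Sbox N j - Sbox (N - L) j)) \<le> \<epsilon> * real (box_size N))"
proof -
  have "\<forall>\<^sub>F N in sequentially. 1 - \<epsilon> < real (box_size N) / real (box_size (N + L))"
    using order_tendstoD(1)[OF box_size_ratio_tendsto, of "1 - \<epsilon>"] assms by simp
  then have "\<forall>\<^sub>F N in sequentially. \<forall>j\<in>carrier G.
      real (card (Sbox (N + L) j - Sbox N j)) \<le> \<epsilon> * real (box_size (N + L))"
  proof (rule eventually_mono, intro ballI)
    fix N j assume ratio: "1 - \<epsilon> < real (box_size N) / real (box_size (N + L))" and j: "j \<in> carrier G"
    have "real (card (Sbox (N + L) j - Sbox N j)) = real (box_size (N + L)) - real (box_size N)"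
      using card_Diff_subset[OF finite_box[OF j, of N] box_mono[of N "N + L" j]]
        card_mono[OF finite_box[OF j] box_mono[of N "N + L" j]]
      by (simp add: card_box[OF j] of_nat_diff)
    moreover have "(1 - \<epsilon>) * real (box_size (N + L)) < real (box_size N)"
      using ratio box_size_pos[of "N + L"] by (simp add: pos_less_divide_eq)
    ultimately show "real (card (Sbox (N + L) j - Sbox N j)) \<le> \<epsilon> * real (box_size (N + L))"
      by (simp add: left_diff_distrib)
  qed
  then obtain N0 where N0: "\<And>N j. N \<ge> N0 \<Longrightarrow> j \<in> carrier G \<Longrightarrow>
      real (card (Sbox (N + L) j - Sbox N j)) \<le> \<epsilon> * real (box_size (N + L))"
    unfolding eventually_sequentially by blast
  have "L \<le> N \<and> (\<forall>j\<in>carrier G. real (card (Sbox N j - Sbox (N - L) j)) \<le> \<epsilon> * real (box_size N))"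
    if "N0 + L \<le> N" for N
  proof -
    have "N0 \<le> N - L" "N - L + L = N" "L \<le> N" using that by simp_all
    with N0[of "N - L"] show ?thesis by simp
  qed
  then show ?thesis unfolding eventually_sequentially by blast
qed

lemma box_size_unbounded: "filterlim box_size at_top sequentially"
  unfolding filterlim_at_top
proof
  fix n
  obtain Q where Q: "Q \<subseteq> carrier G" "finite Q" "card Q = n"
    using infinite_G infinite_arbitrarily_large by blast
  obtain N0 :: nat where "Max (insert 0 ((\<lambda>g. 2 * refdist \<alpha>s ns g \<one>\<^bsub>G\<^esub>) ` Q)) \<le> real N0"
    using real_arch_simple by blast
  then have N0: "2 * refdist \<alpha>s ns g \<one>\<^bsub>G\<^esub> \<le> real N0" if "g \<in> Q" for g
    using that Q(2) by (subst (asm) Max_le_iff) auto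
  have "n \<le> box_size N" if "N0 \<le> N" for N
  proof -
    have "Q \<subseteq> Sbox N \<one>\<^bsub>G\<^esub>"
    proof
      fix g assume g: "g \<in> Q"
      have "real N0 \<le> real N" using that by simp
      with N0[OF g] have "refdist \<alpha>s ns g \<one>\<^bsub>G\<^esub> \<le> real N / 2" by linarith
      with g Q(1) show "g \<in> Sbox N \<one>\<^bsub>G\<^esub>" by (auto simp: S_box_def)
    qed
    then have "card Q \<le> card (Sbox N \<one>\<^bsub>G\<^esub>)" by (intro card_mono finite_box) simp_all
    then show ?thesis by (simp add: Q(3) card_box)
  qed
  then show "\<forall>\<^sub>F N in sequentially. n \<le> box_size N" unfolding eventually_sequentially by blast
qed

text \<open>
  A single \<open>N\<close> for which the ratios are bounded suffices: the fibre over \<open>g\<close> lies in \<open>I\<^sub>N(g)\<close>.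
\<close>

lemma finite_density_bounds_fibres:
  assumes D: "upper_density \<alpha>s ns I a < \<infinity>"
  obtains M where "0 \<le> M" "\<And>Q. finite Q \<Longrightarrow> Q \<subseteq> carrier G \<Longrightarrow>
    finite {i \<in> I. a i \<in> Q} \<and> real (card {i \<in> I. a i \<in> Q}) \<le> M * real (card Q)"
proof -
  obtain C :: ereal where "upper_density \<alpha>s ns I a < C" "C < \<infinity>"
    using D dense by blast
  then have "\<forall>\<^sub>F N in sequentially. (SUP j\<in>carrier G. box_ratio \<alpha>s ns I a N j) < C"
    unfolding upper_density_def by (intro Limsup_lessD)
  then obtain N where N: "(SUP j\<in>carrier G. box_ratio \<alpha>s ns I a N j) < C"
    by (auto simp: eventually_sequentially)
  define M where "M = max 0 (real_of_ereal C * real (box_size N))"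
  have fibre: "finite {i \<in> I. a i = g} \<and> real (card {i \<in> I. a i = g}) \<le> M" if g: "g \<in> carrier G" for g
  proof -
    have "box_ratio \<alpha>s ns I a N g < C" using SUP_lessD[OF N g] .
    then have ratio: "ecount (I_box \<alpha>s ns I a N g) / ereal (real (box_size N)) < C"
      using g by (simp add: box_ratio_def ecount_def finite_box card_box)
    have fin: "finite (I_box \<alpha>s ns I a N g)"
      using ratio \<open>C < \<infinity>\<close> box_size_pos[of N] by (auto simp: ecount_def split: if_splits)
    have "ereal (real (card (I_box \<alpha>s ns I a N g)) / real (box_size N)) < C"
      using ratio fin box_size_pos[of N] by (simp add: ecount_def)
    with \<open>C < \<infinity>\<close> have "real (card (I_box \<alpha>s ns I a N g)) / real (box_size N) < real_of_ereal C"
      by (cases C) auto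
    then have "real (card (I_box \<alpha>s ns I a N g)) \<le> M"
      using box_size_pos[of N] by (simp add: M_def field_simps)
    moreover have sub: "{i \<in> I. a i = g} \<subseteq> I_box \<alpha>s ns I a N g"
      using centre_in_box[OF g] by (auto simp: I_box_def)
    then have "card {i \<in> I. a i = g} \<le> card (I_box \<alpha>s ns I a N g)" using fin by (intro card_mono)
    ultimately show ?thesis using fin sub by (auto intro: finite_subset)
  qed
  show ?thesis
  proof (rule that[of M])
    fix Q assume Q: "finite Q" "Q \<subseteq> carrier G"
    have eq: "{i \<in> I. a i \<in> Q} = (\<Union>g\<in>Q. {i \<in> I. a i = g})" by blast
    have "real (card {i \<in> I. a i \<in> Q}) \<le> (\<Sum>g\<in>Q. real (card {i \<in> I. a i = g}))"
      unfolding eq of_nat_sum[symmetric] of_nat_le_iff by (rule card_UN_le[OF Q(1)])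
    also have "\<dots> \<le> (\<Sum>g\<in>Q. M)" using Q fibre by (intro sum_mono) auto
    finally have "real (card {i \<in> I. a i \<in> Q}) \<le> M * real (card Q)" by (simp add: mult.commute)
    moreover have "finite {i \<in> I. a i \<in> Q}" unfolding eq using Q fibre by auto
    ultimately show "finite {i \<in> I. a i \<in> Q} \<and> real (card {i \<in> I. a i \<in> Q}) \<le> M * real (card Q)"
      by blast
  qed (simp add: M_def)
qed

end

section \<open>Limits along ultrafilters and uniform limits\<close>

lemma eventually_free_ultrafilter_if_sequentially:
  assumes p: "free_ultrafilter p" and P: "eventually P sequentially"
  shows "eventually P p"
proof -
  obtain K where K: "\<And>n. n \<ge> K \<Longrightarrow> P n" using P by (auto simp: eventually_sequentially)
  have "eventually (\<lambda>n. \<forall>m\<in>{..<K}. n \<noteq> m) p"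
    using p unfolding free_ultrafilter_def by (intro eventually_ball_finite) auto
  then show ?thesis
    by (rule eventually_mono) (use K in \<open>auto simp: not_less[symmetric]\<close>)
qed

text \<open>
  By compactness the image of the ultrafilter has a cluster point in the interval, and a cluster
  point of an ultrafilter is a limit.
\<close>

lemma ultrafilter_tendsto_if_bounded:
  fixes u :: "nat \<Rightarrow> real"
  assumes p: "free_ultrafilter p" and u: "\<And>n. a \<le> u n" "\<And>n. u n \<le> b"
  obtains l where "a \<le> l" "l \<le> b" "(u \<longlongrightarrow> l) p"
proof -
  have p_ne: "p \<noteq> bot" and ultra: "eventually P p \<or> eventually (\<lambda>n. \<not> P n) p" for P
    using p by (auto simp: free_ultrafilter_def)
  have "\<exists>l\<in>{a..b}. inf (nhds l) (filtermap u p) \<noteq> bot"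
    using compact_Icc[of a b] p_ne u unfolding compact_filter
    by (auto simp: filtermap_bot_iff eventually_filtermap)
  then obtain l where l: "l \<in> {a..b}" "inf (nhds l) (filtermap u p) \<noteq> bot" by blast
  have "(u \<longlongrightarrow> l) p"
  proof (rule topological_tendstoI)
    fix V assume V: "open V" "l \<in> V"
    show "eventually (\<lambda>n. u n \<in> V) p"
    proof (rule ccontr)
      assume "\<not> eventually (\<lambda>n. u n \<in> V) p"
      then have "eventually (\<lambda>y. y \<notin> V) (filtermap u p)"
        using ultra by (auto simp: eventually_filtermap)
      moreover have "eventually (\<lambda>y. y \<in> V) (nhds l)" using V by (rule eventually_nhds_in_open)
      ultimately have "eventually (\<lambda>_. False) (inf (nhds l) (filtermap u p))"
        unfolding eventually_inf by blast
      with l(2) show False by (simp add: trivial_limit_def)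
    qed
  qed
  with l(1) that show ?thesis by auto
qed

text \<open>
  The last two properties characterize the value: the lower estimate holds for all large \<open>N\<close> and
  all \<open>j\<close>, and infinitely often some \<open>j\<close> comes close to it.
\<close>

lemma liminf_INF_bounded:
  fixes u :: "nat \<Rightarrow> 'a \<Rightarrow> real"
  assumes X: "X \<noteq> {}" and lower: "\<And>N j. j \<in> X \<Longrightarrow> m \<le> u N j" and upper: "\<And>N j. j \<in> X \<Longrightarrow> u N j \<le> M"
  obtains L where "liminf (\<lambda>N. INF j\<in>X. ereal (u N j)) = ereal L" "m \<le> L" "L \<le> M"
    "\<And>\<epsilon>. \<epsilon> > 0 \<Longrightarrow> \<forall>\<^sub>F N in sequentially. \<forall>j\<in>X. L - \<epsilon> \<le> u N j"
    "\<And>\<epsilon>. \<epsilon> > 0 \<Longrightarrow> \<exists>\<^sub>F N in sequentially. \<exists>j\<in>X. u N j < L + \<epsilon>"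
proof -
  let ?v = "\<lambda>N. INF j\<in>X. ereal (u N j)"
  obtain j0 where j0: "j0 \<in> X" using X by blast
  have "ereal m \<le> liminf ?v"
    by (intro Liminf_bounded always_eventually allI INF_greatest) (simp add: lower)
  moreover have "liminf ?v \<le> ereal M"
    by (intro Liminf_le always_eventually allI INF_lower2[OF j0]) (simp_all add: upper[OF j0])
  ultimately obtain L where L: "liminf ?v = ereal L" "m \<le> L" "L \<le> M"
    by (cases "liminf ?v") auto
  show ?thesis
  proof (rule that[OF L])
    fix \<epsilon> :: real assume \<epsilon>: "\<epsilon> > 0"
    then have "ereal (L - \<epsilon>) < liminf ?v" by (simp add: L)
    then have "\<forall>\<^sub>F N in sequentially. ereal (L - \<epsilon>) < ?v N" by (rule less_LiminfD)
    then show "\<forall>\<^sub>F N in sequentially. \<forall>j\<in>X. L - \<epsilon> \<le> u N j"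
    proof (rule eventually_mono, intro ballI)
      fix N j assume "ereal (L - \<epsilon>) < ?v N" "j \<in> X"
      then have "ereal (L - \<epsilon>) < ereal (u N j)" by (rule less_INF_D)
      then show "L - \<epsilon> \<le> u N j" by simp
    qed
    show "\<exists>\<^sub>F N in sequentially. \<exists>j\<in>X. u N j < L + \<epsilon>"
    proof (rule ccontr)
      assume "\<not> ?thesis"
      then have "\<forall>\<^sub>F N in sequentially. \<forall>j\<in>X. L + \<epsilon> \<le> u N j"
        by (simp add: not_frequently not_less)
      then have "\<forall>\<^sub>F N in sequentially. ereal (L + \<epsilon>) \<le> ?v N"
        by (rule eventually_mono) (auto intro: INF_greatest)
      then have "ereal (L + \<epsilon>) \<le> liminf ?v" by (rule Liminf_bounded)
      with \<epsilon> show False by (simp add: L)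
    qed
  qed
qed

lemma limsup_SUP_bounded:
  fixes u :: "nat \<Rightarrow> 'a \<Rightarrow> real"
  assumes X: "X \<noteq> {}" and lower: "\<And>N j. j \<in> X \<Longrightarrow> m \<le> u N j" and upper: "\<And>N j. j \<in> X \<Longrightarrow> u N j \<le> M"
  obtains U where "limsup (\<lambda>N. SUP j\<in>X. ereal (u N j)) = ereal U" "m \<le> U" "U \<le> M"
    "\<And>\<epsilon>. \<epsilon> > 0 \<Longrightarrow> \<forall>\<^sub>F N in sequentially. \<forall>j\<in>X. u N j \<le> U + \<epsilon>"
    "\<And>\<epsilon>. \<epsilon> > 0 \<Longrightarrow> \<exists>\<^sub>F N in sequentially. \<exists>j\<in>X. U - \<epsilon> < u N j"
proof -
  have "(SUP j\<in>X. ereal (u N j)) = - (INF j\<in>X. ereal (- u N j))" for N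
    by (simp add: ereal_INF_uminus_eq flip: uminus_ereal.simps)
  then have neg: "limsup (\<lambda>N. SUP j\<in>X. ereal (u N j)) = - liminf (\<lambda>N. INF j\<in>X. ereal (- u N j))"
    by (simp add: ereal_Limsup_uminus)
  obtain L where L: "liminf (\<lambda>N. INF j\<in>X. ereal (- u N j)) = ereal L" "- M \<le> L" "L \<le> - m"
    "\<And>\<epsilon>. \<epsilon> > 0 \<Longrightarrow> \<forall>\<^sub>F N in sequentially. \<forall>j\<in>X. L - \<epsilon> \<le> - u N j"
    "\<And>\<epsilon>. \<epsilon> > 0 \<Longrightarrow> \<exists>\<^sub>F N in sequentially. \<exists>j\<in>X. - u N j < L + \<epsilon>"
    by (rule liminf_INF_bounded[where u = "\<lambda>N j. - u N j" and X = X and m = "- M" and M = "- m"])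
       (use X lower upper in auto)
  show ?thesis
  proof (rule that[of "- L"])
    fix \<epsilon> :: real assume "\<epsilon> > 0"
    show "\<forall>\<^sub>F N in sequentially. \<forall>j\<in>X. u N j \<le> - L + \<epsilon>"
      using L(4)[OF \<open>\<epsilon> > 0\<close>] by (rule eventually_mono) force
    show "\<exists>\<^sub>F N in sequentially. \<exists>j\<in>X. - L - \<epsilon> < u N j"
      using L(5)[OF \<open>\<epsilon> > 0\<close>] by (rule frequently_mono[rotated]) force
  qed (use L neg in simp_all)
qed

lemma le_if_le_add_mult_small:
  fixes x y C :: real
  assumes "\<And>\<epsilon>. 0 < \<epsilon> \<Longrightarrow> \<epsilon> < 1 \<Longrightarrow> x \<le> y + C * \<epsilon>"
  shows "x \<le> y"
proof (rule tendsto_lowerbound)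
  show "((\<lambda>\<epsilon>. y + C * \<epsilon>) \<longlongrightarrow> y) (at_right 0)"
    by (auto intro!: tendsto_eq_intros)
  show "\<forall>\<^sub>F \<epsilon> in at_right 0. x \<le> y + C * \<epsilon>"
    using eventually_at_right_real[of "0 :: real" 1] by (auto elim!: eventually_mono intro: assms)
qed simp

lemma frequently_Bex_conj_eventually_Ball:
  assumes "\<exists>\<^sub>F N in F. \<exists>j\<in>X. P N j" "\<forall>\<^sub>F N in F. \<forall>j\<in>X. Q N j"
  obtains N j where "j \<in> X" "P N j" "Q N j"
proof -
  from assms have "\<exists>\<^sub>F N in F. (\<exists>j\<in>X. P N j) \<and> (\<forall>j\<in>X. Q N j)"
    by (rule frequently_eventually_frequently)
  then show ?thesis using that by (auto dest!: frequently_ex)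
qed

text \<open>
  Each inequality is obtained by evaluating \<open>x \<approx> r y\<close> at one well-chosen pair \<open>(N, j)\<close>: one factor is
  taken close to its extremal value, which is possible infinitely often, while the bounds for the
  other two quantities hold for all large \<open>N\<close> and all \<open>j\<close>. For instance \<open>Lx \<le> Ur * Ly\<close> comes from a pair
  at which \<open>y\<close> almost attains \<open>Ly\<close>, and \<open>Ur * Ly \<le> Ux\<close> from one at which \<open>r\<close> almost attains \<open>Ur\<close>.
\<close>

lemma uniform_product_limits:
  fixes x r y :: "nat \<Rightarrow> 'a \<Rightarrow> real"
  assumes X: "X \<noteq> {}"
    and x: "\<And>N j. j \<in> X \<Longrightarrow> 0 \<le> x N j" "\<And>N j. j \<in> X \<Longrightarrow> x N j \<le> 1"
    and r: "\<And>N j. j \<in> X \<Longrightarrow> 0 \<le> r N j" "\<And>N j. j \<in> X \<Longrightarrow> r N j \<le> M"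
    and y: "\<And>N j. j \<in> X \<Longrightarrow> 0 \<le> y N j" "\<And>N j. j \<in> X \<Longrightarrow> y N j \<le> 1"
    and close: "\<And>\<epsilon>. \<epsilon> > 0 \<Longrightarrow> \<forall>\<^sub>F N in sequentially. \<forall>j\<in>X. \<bar>x N j - r N j * y N j\<bar> \<le> \<epsilon>"
  obtains Lx Ux Lr Ur Ly Uy where
    "liminf (\<lambda>N. INF j\<in>X. ereal (x N j)) = ereal Lx" "limsup (\<lambda>N. SUP j\<in>X. ereal (x N j)) = ereal Ux"
    "liminf (\<lambda>N. INF j\<in>X. ereal (r N j)) = ereal Lr" "limsup (\<lambda>N. SUP j\<in>X. ereal (r N j)) = ereal Ur"
    "liminf (\<lambda>N. INF j\<in>X. ereal (y N j)) = ereal Ly" "limsup (\<lambda>N. SUP j\<in>X. ereal (y N j)) = ereal Uy"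
    "Lx \<le> Ur * Ly" "Ur * Ly \<le> Ux" "Lx \<le> Lr * Uy" "Lr * Uy \<le> Ux"
    "0 \<le> Lr" "Uy \<le> 1" "0 \<le> Ux"
proof -
  obtain Lx where Lx: "liminf (\<lambda>N. INF j\<in>X. ereal (x N j)) = ereal Lx"
    and Lx_ev: "\<And>\<epsilon>. \<epsilon> > 0 \<Longrightarrow> \<forall>\<^sub>F N in sequentially. \<forall>j\<in>X. Lx - \<epsilon> \<le> x N j"
    by (rule liminf_INF_bounded[of X 0 x 1, OF X x]) blast+
  obtain Ux where Ux: "limsup (\<lambda>N. SUP j\<in>X. ereal (x N j)) = ereal Ux" "0 \<le> Ux"
    and Ux_ev: "\<And>\<epsilon>. \<epsilon> > 0 \<Longrightarrow> \<forall>\<^sub>F N in sequentially. \<forall>j\<in>X. x N j \<le> Ux + \<epsilon>"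
    by (rule limsup_SUP_bounded[of X 0 x 1, OF X x]) blast+
  obtain Lr where Lr: "liminf (\<lambda>N. INF j\<in>X. ereal (r N j)) = ereal Lr" "0 \<le> Lr"
    and Lr_ev: "\<And>\<epsilon>. \<epsilon> > 0 \<Longrightarrow> \<forall>\<^sub>F N in sequentially. \<forall>j\<in>X. Lr - \<epsilon> \<le> r N j"
    and Lr_fr: "\<And>\<epsilon>. \<epsilon> > 0 \<Longrightarrow> \<exists>\<^sub>F N in sequentially. \<exists>j\<in>X. r N j < Lr + \<epsilon>"
    by (rule liminf_INF_bounded[of X 0 r M, OF X r]) blast+
  obtain Ur where Ur: "limsup (\<lambda>N. SUP j\<in>X. ereal (r N j)) = ereal Ur" "0 \<le> Ur"
    and Ur_ev: "\<And>\<epsilon>. \<epsilon> > 0 \<Longrightarrow> \<forall>\<^sub>F N in sequentially. \<forall>j\<in>X. r N j \<le> Ur + \<epsilon>"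
    and Ur_fr: "\<And>\<epsilon>. \<epsilon> > 0 \<Longrightarrow> \<exists>\<^sub>F N in sequentially. \<exists>j\<in>X. Ur - \<epsilon> < r N j"
    by (rule limsup_SUP_bounded[of X 0 r M, OF X r]) blast+
  obtain Ly where Ly: "liminf (\<lambda>N. INF j\<in>X. ereal (y N j)) = ereal Ly" "0 \<le> Ly"
    and Ly_ev: "\<And>\<epsilon>. \<epsilon> > 0 \<Longrightarrow> \<forall>\<^sub>F N in sequentially. \<forall>j\<in>X. Ly - \<epsilon> \<le> y N j"
    and Ly_fr: "\<And>\<epsilon>. \<epsilon> > 0 \<Longrightarrow> \<exists>\<^sub>F N in sequentially. \<exists>j\<in>X. y N j < Ly + \<epsilon>"
    by (rule liminf_INF_bounded[of X 0 y 1, OF X y]) blast+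
  obtain Uy where Uy: "limsup (\<lambda>N. SUP j\<in>X. ereal (y N j)) = ereal Uy" "0 \<le> Uy" "Uy \<le> 1"
    and Uy_ev: "\<And>\<epsilon>. \<epsilon> > 0 \<Longrightarrow> \<forall>\<^sub>F N in sequentially. \<forall>j\<in>X. y N j \<le> Uy + \<epsilon>"
    and Uy_fr: "\<And>\<epsilon>. \<epsilon> > 0 \<Longrightarrow> \<exists>\<^sub>F N in sequentially. \<exists>j\<in>X. Uy - \<epsilon> < y N j"
    by (rule limsup_SUP_bounded[of X 0 y 1, OF X y]) blast+
  have upper_product: "l \<le> R * Y"
    if \<epsilon>: "\<And>\<epsilon>. 0 < \<epsilon> \<Longrightarrow> \<epsilon> < 1 \<Longrightarrow> \<exists>N. \<exists>j\<in>X. r N j \<le> R + \<epsilon> \<and> y N j \<le> Y + \<epsilon> \<and> l - \<epsilon> \<le> x N j \<and>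
        \<bar>x N j - r N j * y N j\<bar> \<le> \<epsilon>"
      and nonneg: "0 \<le> R" "0 \<le> Y" for l R Y
  proof (rule le_if_le_add_mult_small[where C = "3 + R + Y"])
    fix \<epsilon> :: real assume eps: "0 < \<epsilon>" "\<epsilon> < 1"
    from \<epsilon>[OF this] obtain N j where j: "j \<in> X" "r N j \<le> R + \<epsilon>" "y N j \<le> Y + \<epsilon>"
      "l - \<epsilon> \<le> x N j" "\<bar>x N j - r N j * y N j\<bar> \<le> \<epsilon>" by blast
    have "r N j * y N j \<le> (R + \<epsilon>) * (Y + \<epsilon>)"
      using j r(1)[OF j(1)] y(1)[OF j(1)] nonneg eps by (intro mult_mono) auto
    also have "\<dots> \<le> R * Y + (1 + R + Y) * \<epsilon>"
      using mult_right_mono[of \<epsilon> 1 \<epsilon>] eps by (simp add: algebra_simps)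
    finally show "l \<le> R * Y + (3 + R + Y) * \<epsilon>" using j by (simp add: algebra_simps)
  qed
  have lower_product: "R * Y \<le> u"
    if \<epsilon>: "\<And>\<epsilon>. 0 < \<epsilon> \<Longrightarrow> \<epsilon> < 1 \<Longrightarrow> \<exists>N. \<exists>j\<in>X. R - \<epsilon> \<le> r N j \<and> Y - \<epsilon> \<le> y N j \<and> x N j \<le> u + \<epsilon> \<and>
        \<bar>x N j - r N j * y N j\<bar> \<le> \<epsilon>"
      and nonneg: "0 \<le> R" for u R Y
  proof (rule le_if_le_add_mult_small[where C = "3 + R"])
    fix \<epsilon> :: real assume eps: "0 < \<epsilon>" "\<epsilon> < 1"
    from \<epsilon>[OF this] obtain N j where j: "j \<in> X" "R - \<epsilon> \<le> r N j" "Y - \<epsilon> \<le> y N j"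
      "x N j \<le> u + \<epsilon>" "\<bar>x N j - r N j * y N j\<bar> \<le> \<epsilon>" by blast
    have "(R - \<epsilon>) * y N j \<le> r N j * y N j" using j y by (intro mult_right_mono) auto
    moreover have "R * (Y - \<epsilon>) \<le> R * y N j" using j nonneg by (intro mult_left_mono) auto
    moreover have "\<epsilon> * y N j \<le> \<epsilon> * 1" using j y eps by (intro mult_left_mono) auto
    ultimately show "R * Y \<le> u + (3 + R) * \<epsilon>" using j by (simp add: algebra_simps)
  qed
  have bounds: "\<forall>\<^sub>F N in sequentially. \<forall>j\<in>X. Lr - \<epsilon> \<le> r N j \<and> r N j \<le> Ur + \<epsilon> \<and>
      Ly - \<epsilon> \<le> y N j \<and> y N j \<le> Uy + \<epsilon> \<and> Lx - \<epsilon> \<le> x N j \<and> x N j \<le> Ux + \<epsilon> \<and>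
      \<bar>x N j - r N j * y N j\<bar> \<le> \<epsilon>" if "\<epsilon> > 0" for \<epsilon>
    using Lr_ev[OF that] Ur_ev[OF that] Ly_ev[OF that] Uy_ev[OF that] Lx_ev[OF that] Ux_ev[OF that]
      close[OF that]
    by eventually_elim blast
  have "Lx \<le> Ur * Ly"
  proof (rule upper_product)
    fix \<epsilon> :: real assume "0 < \<epsilon>"
    from frequently_Bex_conj_eventually_Ball[OF Ly_fr[OF this] bounds[OF this]]
    show "\<exists>N. \<exists>j\<in>X. r N j \<le> Ur + \<epsilon> \<and> y N j \<le> Ly + \<epsilon> \<and> Lx - \<epsilon> \<le> x N j \<and>
        \<bar>x N j - r N j * y N j\<bar> \<le> \<epsilon>" by (metis less_imp_le)
  qed (use Ur Ly in auto)
  moreover have "Ur * Ly \<le> Ux"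
  proof (rule lower_product)
    fix \<epsilon> :: real assume "0 < \<epsilon>"
    from frequently_Bex_conj_eventually_Ball[OF Ur_fr[OF this] bounds[OF this]]
    show "\<exists>N. \<exists>j\<in>X. Ur - \<epsilon> \<le> r N j \<and> Ly - \<epsilon> \<le> y N j \<and> x N j \<le> Ux + \<epsilon> \<and>
        \<bar>x N j - r N j * y N j\<bar> \<le> \<epsilon>" by (metis less_imp_le)
  qed (use Ur in auto)
  moreover have "Lx \<le> Lr * Uy"
  proof (rule upper_product)
    fix \<epsilon> :: real assume "0 < \<epsilon>"
    from frequently_Bex_conj_eventually_Ball[OF Lr_fr[OF this] bounds[OF this]]
    show "\<exists>N. \<exists>j\<in>X. r N j \<le> Lr + \<epsilon> \<and> y N j \<le> Uy + \<epsilon> \<and> Lx - \<epsilon> \<le> x N j \<and>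
        \<bar>x N j - r N j * y N j\<bar> \<le> \<epsilon>" by (metis less_imp_le)
  qed (use Lr Uy in auto)
  moreover have "Lr * Uy \<le> Ux"
  proof (rule lower_product)
    fix \<epsilon> :: real assume "0 < \<epsilon>"
    from frequently_Bex_conj_eventually_Ball[OF Uy_fr[OF this] bounds[OF this]]
    show "\<exists>N. \<exists>j\<in>X. Lr - \<epsilon> \<le> r N j \<and> Uy - \<epsilon> \<le> y N j \<and> x N j \<le> Ux + \<epsilon> \<and>
        \<bar>x N j - r N j * y N j\<bar> \<le> \<epsilon>" by (metis less_imp_le)
  qed (use Lr in auto)
  ultimately show ?thesis
    using that Lx Ux Lr Ur Ly Uy by blast
qed

section \<open>Localized frames\<close>

locale localized_frames =
  frame_pair smul ip I f A B "carrier (refgroup \<alpha>s ns)" e A' B' + reference_group \<alpha>s ns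
  for smul :: "'k::real_or_complex \<Rightarrow> 'h::banach \<Rightarrow> 'h" and ip :: "'h \<Rightarrow> 'h \<Rightarrow> 'k"
    and I :: "'i set" and f :: "'i \<Rightarrow> 'h" and A B :: real
    and \<alpha>s :: "real list" and ns :: "nat list"
    and e :: "refelem \<Rightarrow> 'h" and A' B' :: real +
  fixes a :: "'i \<Rightarrow> refelem"
  assumes a: "a \<in> I \<rightarrow> carrier (refgroup \<alpha>s ns)"
    and finite_density: "upper_density \<alpha>s ns I a < \<infinity>"
    and column_decay: "l2_column_decay ip \<alpha>s ns I f a e"
    and row_decay: "l2_row_decay ip \<alpha>s ns I f a e"
begin

abbreviation Ibox :: "nat \<Rightarrow> refelem \<Rightarrow> 'i set" where "Ibox \<equiv> I_box \<alpha>s ns I a"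
abbreviation avg_F :: "nat \<Rightarrow> refelem \<Rightarrow> real" where "avg_F \<equiv> average_F smul ip \<alpha>s ns I a f"
abbreviation avg_E :: "nat \<Rightarrow> refelem \<Rightarrow> real" where "avg_E \<equiv> average_E smul ip \<alpha>s ns e"

definition ratio :: "nat \<Rightarrow> refelem \<Rightarrow> real" where
  "ratio N j = real (card (Ibox N j)) / real (box_size N)"

text \<open>
  Some constant as in \<open>finite_density_bounds_fibres\<close>; in particular the fibres of \<open>a\<close> have at most that
  many elements.
\<close>

definition fibre_bound :: real where
  "fibre_bound = (SOME M. 0 \<le> M \<and> (\<forall>Q. finite Q \<longrightarrow> Q \<subseteq> carrier G \<longrightarrow>
    finite {i \<in> I. a i \<in> Q} \<and> real (card {i \<in> I. a i \<in> Q}) \<le> M * real (card Q)))"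

lemma fibre_bound_nonneg: "0 \<le> fibre_bound"
  and finite_fibres: "finite Q \<Longrightarrow> Q \<subseteq> carrier G \<Longrightarrow> finite {i \<in> I. a i \<in> Q}"
  and card_fibres_le: "finite Q \<Longrightarrow> Q \<subseteq> carrier G \<Longrightarrow>
    real (card {i \<in> I. a i \<in> Q}) \<le> fibre_bound * real (card Q)"
proof -
  have "\<exists>M. 0 \<le> M \<and> (\<forall>Q. finite Q \<longrightarrow> Q \<subseteq> carrier G \<longrightarrow>
      finite {i \<in> I. a i \<in> Q} \<and> real (card {i \<in> I. a i \<in> Q}) \<le> M * real (card Q))"
    by (rule finite_density_bounds_fibres[OF finite_density]) blast
  from someI_ex[OF this, folded fibre_bound_def]
  show "0 \<le> fibre_bound"
    and "finite Q \<Longrightarrow> Q \<subseteq> carrier G \<Longrightarrow> finite {i \<in> I. a i \<in> Q}"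
    and "finite Q \<Longrightarrow> Q \<subseteq> carrier G \<Longrightarrow> real (card {i \<in> I. a i \<in> Q}) \<le> fibre_bound * real (card Q)"
    by blast+
qed

lemma finite_Ibox: "j \<in> carrier G \<Longrightarrow> finite (Ibox N j)"
  unfolding I_box_def by (intro finite_fibres finite_box box_subset_carrier)

lemma ratio_nonneg: "0 \<le> ratio N j"
  by (simp add: ratio_def)

lemma ratio_le: "j \<in> carrier G \<Longrightarrow> ratio N j \<le> fibre_bound"
  using card_fibres_le[OF finite_box box_subset_carrier, of j N] box_size_pos[of N]
  by (simp add: ratio_def I_box_def card_box field_simps)

lemma box_ratio_eq: "j \<in> carrier G \<Longrightarrow> box_ratio \<alpha>s ns I a N j = ereal (ratio N j)"
  using finite_Ibox[of j N] finite_box[of j N] box_size_pos[of N]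
  by (simp add: box_ratio_def ecount_def ratio_def card_box)

lemma avg_F_eq: "avg_F N j = sum F.leverage (Ibox N j) / real (card (Ibox N j))"
  by (simp add: average_F_def F.leverage_def)

lemma avg_E_eq: "j \<in> carrier G \<Longrightarrow> avg_E N j = sum E.leverage (Sbox N j) / real (box_size N)"
  by (simp add: average_E_def E.leverage_def card_box F.ip_commute[of _ "e _"])

text \<open>
  This holds even for an empty box, where the average is \<open>0\<close> by convention and the sum is empty.
\<close>

lemma ratio_mult_avg_F:
  assumes "j \<in> carrier G"
  shows "ratio N j * avg_F N j = sum F.leverage (Ibox N j) / real (box_size N)"
  using finite_Ibox[OF assms, of N] by (cases "Ibox N j = {}") (simp_all add: ratio_def avg_F_eq)

lemma avg_F_bounds:
  shows "0 \<le> avg_F N j" and "avg_F N j \<le> 1"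
proof -
  show "0 \<le> avg_F N j"
    unfolding avg_F_eq by (intro divide_nonneg_nonneg sum_nonneg F.leverage_nonneg) simp
  have "sum F.leverage (Ibox N j) \<le> (\<Sum>i\<in>Ibox N j. 1)"
    by (intro sum_mono F.leverage_le_1) (simp add: I_box_def)
  then show "avg_F N j \<le> 1" unfolding avg_F_eq by (auto simp: divide_le_eq_1)
qed

lemma avg_E_bounds:
  assumes "j \<in> carrier G"
  shows "0 \<le> avg_E N j" and "avg_E N j \<le> 1"
proof -
  show "0 \<le> avg_E N j"
    unfolding avg_E_eq[OF assms] by (intro divide_nonneg_nonneg sum_nonneg E.leverage_nonneg) simp
  have "sum E.leverage (Sbox N j) \<le> (\<Sum>k\<in>Sbox N j. 1)"
    by (intro sum_mono E.leverage_le_1 subsetD[OF box_subset_carrier])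
  then show "avg_E N j \<le> 1"
    unfolding avg_E_eq[OF assms] using card_box[OF assms] box_size_pos[of N] by (simp add: divide_le_eq_1)
qed

text \<open>
  The decay hypotheses provide a radius \<open>L\<close> outside of which rows and columns have square sum at most
  \<open>\<eta>\<^sup>2\<close>. Compare the boxes of sizes \<open>N\<close> and \<open>N - L\<close>: a box of size \<open>L\<close> centred in the smaller one lies in the
  larger one, and the shell between them is negligible for large \<open>N\<close>.
\<close>

lemma averages_close:
  assumes "\<epsilon> > 0"
  shows "\<forall>\<^sub>F N in sequentially. \<forall>j\<in>carrier G. \<bar>avg_E N j - ratio N j * avg_F N j\<bar> \<le> \<epsilon>"
proof -
  obtain K where K: "0 \<le> K" and comparison:
    "\<And>P P' Q Q' \<epsilon>. \<lbrakk>finite P; P \<subseteq> I; P' \<subseteq> P; finite Q; Q \<subseteq> carrier G; Q' \<subseteq> Q; 0 \<le> \<epsilon>;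
       \<And>i F. i \<in> P' \<Longrightarrow> finite F \<Longrightarrow> F \<subseteq> carrier G - Q \<Longrightarrow> (\<Sum>k\<in>F. (norm (ip (f i) (e k)))\<^sup>2) \<le> \<epsilon>;
       \<And>k F. k \<in> Q' \<Longrightarrow> finite F \<Longrightarrow> F \<subseteq> I - P \<Longrightarrow> (\<Sum>i\<in>F. (norm (ip (f i) (e k)))\<^sup>2) \<le> \<epsilon>\<rbrakk> \<Longrightarrow>
     \<bar>sum F.leverage P - sum E.leverage Q\<bar>
       \<le> K * (sqrt \<epsilon> * real (card P) + real (card (P - P')))
         + K * (sqrt \<epsilon> * real (card Q) + real (card (Q - Q')))"
    using leverage_sum_comparison by blast
  define C where "C = K * (1 + fibre_bound)"
  have C: "0 \<le> C" using K fibre_bound_nonneg by (simp add: C_def)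
  \<comment> \<open>Cores and shells each contribute at most \<open>C \<eta>\<close> times the size of the box.\<close>
  define \<eta> where "\<eta> = \<epsilon> / (2 * (C + 1))"
  have \<eta>: "0 < \<eta>" using assms C by (simp add: \<eta>_def)
  have \<eta>_small: "C * (2 * \<eta>) \<le> \<epsilon>"
    using assms C by (simp add: \<eta>_def field_simps)
  have \<eta>2: "0 < \<eta>\<^sup>2" using \<eta> by simp
  obtain Lr where row: "\<And>i. i \<in> I \<Longrightarrow>
      (\<lambda>k. (norm (ip (f i) (e k)))\<^sup>2) summable_on (carrier G - Sbox Lr (a i)) \<and>
      (\<Sum>\<^sub>\<infinity>k\<in>carrier G - Sbox Lr (a i). (norm (ip (f i) (e k)))\<^sup>2) < \<eta>\<^sup>2"
    using row_decay \<eta>2 unfolding l2_row_decay_def by blast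
  obtain Lc where col: "\<And>k. k \<in> carrier G \<Longrightarrow>
      (\<lambda>i. (norm (ip (f i) (e k)))\<^sup>2) summable_on (I - Ibox Lc k) \<and>
      (\<Sum>\<^sub>\<infinity>i\<in>I - Ibox Lc k. (norm (ip (f i) (e k)))\<^sup>2) < \<eta>\<^sup>2"
    using column_decay \<eta>2 unfolding l2_column_decay_def by blast
  define L where "L = max Lr Lc"
  show ?thesis using card_shell_small[OF \<eta>, of L]
  proof (rule eventually_mono, intro ballI)
    fix N j
    assume shell: "L \<le> N \<and> (\<forall>j\<in>carrier G. real (card (Sbox N j - Sbox (N - L) j)) \<le> \<eta> * real (box_size N))"
      and j: "j \<in> carrier G"
    let ?P = "Ibox N j" and ?P' = "Ibox (N - L) j" and ?Q = "Sbox N j" and ?Q' = "Sbox (N - L) j"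
    define s where "s = real (box_size N)"
    have s: "0 < s" using box_size_pos by (simp add: s_def)
    have card_Q: "real (card ?Q) = s" by (simp add: s_def card_box j)
    have Q'_sub: "?Q' \<subseteq> ?Q" by (rule box_mono) simp
    have shell_Q: "real (card (?Q - ?Q')) \<le> \<eta> * s" using shell j by (simp add: s_def)
    have card_P: "real (card ?P) \<le> fibre_bound * s"
      unfolding I_box_def card_Q[symmetric] by (intro card_fibres_le finite_box box_subset_carrier j)
    have "?P - ?P' = {i \<in> I. a i \<in> ?Q - ?Q'}" by (auto simp: I_box_def)
    then have "real (card (?P - ?P')) \<le> fibre_bound * real (card (?Q - ?Q'))"
      using card_fibres_le[of "?Q - ?Q'"] finite_box[OF j, of N] box_subset_carrier[of N j]
      by (simp add: subset_iff)
    also have "\<dots> \<le> fibre_bound * (\<eta> * s)"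
      by (intro mult_left_mono shell_Q fibre_bound_nonneg)
    finally have shell_P: "real (card (?P - ?P')) \<le> fibre_bound * (\<eta> * s)" .
    have "\<bar>sum F.leverage ?P - sum E.leverage ?Q\<bar>
       \<le> K * (sqrt (\<eta>\<^sup>2) * real (card ?P) + real (card (?P - ?P')))
         + K * (sqrt (\<eta>\<^sup>2) * real (card ?Q) + real (card (?Q - ?Q')))"
    proof (rule comparison)
      show "finite ?P" "finite ?Q" by (rule finite_Ibox[OF j] finite_box[OF j])+
      show "?P \<subseteq> I" "?P' \<subseteq> ?P" "?Q \<subseteq> carrier G" "?Q' \<subseteq> ?Q" "0 \<le> \<eta>\<^sup>2"
        using Q'_sub box_subset_carrier by (auto simp: I_box_def)
    next
      fix i F assume i: "i \<in> ?P'" and F: "finite F" "F \<subseteq> carrier G - ?Q"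
      have iI: "i \<in> I" and ai: "a i \<in> ?Q'" using i by (auto simp: I_box_def)
      have "Sbox Lr (a i) \<subseteq> ?Q"
        using box_trans[OF _ ai _ j] box_mono[of Lr L "a i"] shell by (auto simp: L_def)
      then have "F \<subseteq> carrier G - Sbox Lr (a i)" using F by blast
      then have "(\<Sum>k\<in>F. (norm (ip (f i) (e k)))\<^sup>2)
          \<le> (\<Sum>\<^sub>\<infinity>k\<in>carrier G - Sbox Lr (a i). (norm (ip (f i) (e k)))\<^sup>2)"
        using row[OF iI] F(1) by (intro finite_sum_le_infsum) auto
      then show "(\<Sum>k\<in>F. (norm (ip (f i) (e k)))\<^sup>2) \<le> \<eta>\<^sup>2" using row[OF iI] by linarith
    next
      fix k F assume k: "k \<in> ?Q'" and F: "finite F" "F \<subseteq> I - ?P"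
      have kG: "k \<in> carrier G" using k box_subset_carrier by blast
      have "Sbox Lc k \<subseteq> ?Q"
        using box_trans[OF _ k _ j] box_mono[of Lc L k] shell by (auto simp: L_def)
      then have "Ibox Lc k \<subseteq> ?P" unfolding I_box_def by blast
      then have "F \<subseteq> I - Ibox Lc k" using F by blast
      then have "(\<Sum>i\<in>F. (norm (ip (f i) (e k)))\<^sup>2)
          \<le> (\<Sum>\<^sub>\<infinity>i\<in>I - Ibox Lc k. (norm (ip (f i) (e k)))\<^sup>2)"
        using col[OF kG] F(1) by (intro finite_sum_le_infsum) auto
      then show "(\<Sum>i\<in>F. (norm (ip (f i) (e k)))\<^sup>2) \<le> \<eta>\<^sup>2" using col[OF kG] by linarith
    qed
    also have "\<dots> \<le> K * (\<eta> * (fibre_bound * s) + fibre_bound * (\<eta> * s)) + K * (\<eta> * s + \<eta> * s)"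
      using \<eta> K card_P card_Q shell_P shell_Q
      by (intro add_mono mult_left_mono) simp_all
    also have "\<dots> = C * (2 * \<eta>) * s" by (simp add: C_def algebra_simps)
    also have "\<dots> \<le> \<epsilon> * s" using \<eta>_small s by (intro mult_right_mono) auto
    finally have "\<bar>sum F.leverage ?P - sum E.leverage ?Q\<bar> \<le> \<epsilon> * s" .
    moreover have "avg_E N j - ratio N j * avg_F N j = (sum E.leverage ?Q - sum F.leverage ?P) / s"
      unfolding avg_E_eq[OF j] ratio_mult_avg_F[OF j] s_def by (simp add: diff_divide_distrib)
    ultimately show "\<bar>avg_E N j - ratio N j * avg_F N j\<bar> \<le> \<epsilon>"
      using s by (simp add: abs_divide divide_le_eq abs_minus_commute)
  qed
qed

lemma carrier_nonempty: "carrier G \<noteq> {}"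
  using infinite_G by auto

lemma INF_box_ratio: "(INF j\<in>carrier G. box_ratio \<alpha>s ns I a N j) = (INF j\<in>carrier G. ereal (ratio N j))"
  and SUP_box_ratio: "(SUP j\<in>carrier G. box_ratio \<alpha>s ns I a N j) = (SUP j\<in>carrier G. ereal (ratio N j))"
  by (simp_all add: box_ratio_eq cong: INF_cong SUP_cong)

lemma extremal_measures:
  obtains Lx Ux Lr Ur Ly Uy where
    "lower_measure_E smul ip \<alpha>s ns e = ereal Lx" "upper_measure_E smul ip \<alpha>s ns e = ereal Ux"
    "lower_density \<alpha>s ns I a = ereal Lr" "upper_density \<alpha>s ns I a = ereal Ur"
    "lower_measure_F smul ip \<alpha>s ns I a f = ereal Ly" "upper_measure_F smul ip \<alpha>s ns I a f = ereal Uy"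
    "Lx \<le> Ur * Ly" "Ur * Ly \<le> Ux" "Lx \<le> Lr * Uy" "Lr * Uy \<le> Ux"
    "0 \<le> Lr" "Uy \<le> 1" "0 \<le> Ux"
  by (rule uniform_product_limits[of "carrier G" avg_E ratio fibre_bound avg_F, OF carrier_nonempty
        avg_E_bounds ratio_nonneg ratio_le avg_F_bounds averages_close])
     (assumption | rule that[unfolded lower_measure_E_def upper_measure_E_def lower_density_def
        upper_density_def lower_measure_F_def upper_measure_F_def INF_box_ratio SUP_box_ratio])+

lemma limits_along_ultrafilter:
  assumes p: "free_ultrafilter p" and c: "\<And>N. c N \<in> carrier G"
  obtains X R Y where "measure_E smul ip \<alpha>s ns e p c = ereal X"
    "density_along \<alpha>s ns I a p c = ereal R" "measure_F smul ip \<alpha>s ns I a f p c = ereal Y" "X = R * Y"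
proof -
  have p_ne: "p \<noteq> bot" using p by (simp add: free_ultrafilter_def)
  obtain X where X: "((\<lambda>N. avg_E N (c N)) \<longlongrightarrow> X) p"
    by (rule ultrafilter_tendsto_if_bounded[OF p, of 0 "\<lambda>N. avg_E N (c N)" 1]) (simp_all add: avg_E_bounds c)
  obtain R where R: "((\<lambda>N. ratio N (c N)) \<longlongrightarrow> R) p"
    by (rule ultrafilter_tendsto_if_bounded[OF p, of 0 "\<lambda>N. ratio N (c N)" fibre_bound])
       (simp_all add: ratio_nonneg ratio_le c)
  obtain Y where Y: "((\<lambda>N. avg_F N (c N)) \<longlongrightarrow> Y) p"
    by (rule ultrafilter_tendsto_if_bounded[OF p, of 0 "\<lambda>N. avg_F N (c N)" 1]) (simp_all add: avg_F_bounds)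
  have "((\<lambda>N. avg_E N (c N) - ratio N (c N) * avg_F N (c N)) \<longlongrightarrow> 0) p"
  proof (rule tendstoI)
    fix \<epsilon> :: real assume "\<epsilon> > 0"
    then have "\<forall>\<^sub>F N in p. \<forall>j\<in>carrier G. \<bar>avg_E N j - ratio N j * avg_F N j\<bar> \<le> \<epsilon> / 2"
      by (intro eventually_free_ultrafilter_if_sequentially[OF p] averages_close) simp
    then show "\<forall>\<^sub>F N in p. dist (avg_E N (c N) - ratio N (c N) * avg_F N (c N)) 0 < \<epsilon>"
      using \<open>\<epsilon> > 0\<close> c by (auto elim!: eventually_mono simp: dist_real_def) (smt (verit) c field_sum_of_halves)
  qed
  moreover have "((\<lambda>N. avg_E N (c N) - ratio N (c N) * avg_F N (c N)) \<longlongrightarrow> X - R * Y) p"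
    by (intro tendsto_intros X R Y)
  ultimately have "X = R * Y" using tendsto_unique[OF p_ne] by fastforce
  moreover have "measure_E smul ip \<alpha>s ns e p c = ereal X"
    unfolding measure_E_def using X by (intro tendsto_Lim p_ne) simp
  moreover have "density_along \<alpha>s ns I a p c = ereal R"
    unfolding density_along_def using R by (intro tendsto_Lim p_ne) (simp add: box_ratio_eq c)
  moreover have "measure_F smul ip \<alpha>s ns I a f p c = ereal Y"
    unfolding measure_F_def using Y by (intro tendsto_Lim p_ne) simp
  ultimately show ?thesis using that by blast
qed

text \<open>
  Let \<open>X < R\<close> be the two sides of the hypothesis. There are large boxes of ratio close to \<open>R\<close> in which
  the leverages of \<open>\<F>\<close> add up to little more than \<open>X\<close> times the size. If all but finitely many
  leverages exceeded \<open>1 - \<delta>\<close>, their sum would be at least almost \<open>(1 - \<delta>) R\<close> times the size, which is too much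
  for small \<open>\<delta>\<close>.
\<close>

lemma removable_if_density_exceeds_measure:
  assumes exceeds: "upper_density \<alpha>s ns I a > upper_measure_E smul ip \<alpha>s ns e"
  shows "\<exists>J\<subseteq>I. infinite J \<and> is_frame ip (I - J) f"
proof -
  obtain R where R: "limsup (\<lambda>N. SUP j\<in>carrier G. ereal (ratio N j)) = ereal R"
    and R_freq: "\<And>\<epsilon>. \<epsilon> > 0 \<Longrightarrow> \<exists>\<^sub>F N in sequentially. \<exists>j\<in>carrier G. R - \<epsilon> < ratio N j"
    by (rule limsup_SUP_bounded[of "carrier G" 0 ratio fibre_bound, OF carrier_nonempty ratio_nonneg ratio_le])
       blast+
  obtain X where X: "limsup (\<lambda>N. SUP j\<in>carrier G. ereal (avg_E N j)) = ereal X" "0 \<le> X"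
    and X_ev: "\<And>\<epsilon>. \<epsilon> > 0 \<Longrightarrow> \<forall>\<^sub>F N in sequentially. \<forall>j\<in>carrier G. avg_E N j \<le> X + \<epsilon>"
    by (rule limsup_SUP_bounded[of "carrier G" 0 avg_E 1, OF carrier_nonempty avg_E_bounds]) blast+
  have "X < R"
    using exceeds by (simp add: upper_density_def SUP_box_ratio upper_measure_E_def R X)
  \<comment> \<open>Two errors of size \<open>t\<close> enter on each side, which leaves \<open>R - 2 t\<close> above \<open>X + 2 t\<close> by \<open>t\<close>. The factor
    \<open>1 - \<delta>\<close> uses up half of that margin.\<close>
  define t where "t = (R - X) / 5"
  have t: "0 < t" using \<open>X < R\<close> by (simp add: t_def)
  define \<delta> where "\<delta> = t / (2 * (X + 3 * t))"
  have \<delta>: "0 < \<delta>" using t X(2) by (simp add: \<delta>_def)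
  have "X + 3 * t \<noteq> 0" using t X(2) by simp
  then have \<delta>_gap: "\<delta> * (X + 3 * t) = t / 2" unfolding \<delta>_def by (simp add: field_simps)
  have "\<delta> \<le> 1" using t X(2) by (simp add: \<delta>_def)
  define K where "K = {i \<in> I. F.leverage i \<le> 1 - \<delta>}"
  have "infinite K"
  proof
    assume fin: "finite K"
    have "\<forall>\<^sub>F N in sequentially. nat \<lceil>real (card K) / t\<rceil> \<le> box_size N"
      using box_size_unbounded unfolding filterlim_at_top by blast
    then have "\<forall>\<^sub>F N in sequentially. \<forall>j\<in>carrier G. avg_E N j \<le> X + t \<and>
        \<bar>avg_E N j - ratio N j * avg_F N j\<bar> \<le> t \<and> nat \<lceil>real (card K) / t\<rceil> \<le> box_size N"
      using X_ev[OF t] averages_close[OF t] by eventually_elim blast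
    from frequently_Bex_conj_eventually_Ball[OF R_freq[OF t] this] obtain N j
      where j: "j \<in> carrier G" and dense: "R - t < ratio N j" and avg: "avg_E N j \<le> X + t"
        "\<bar>avg_E N j - ratio N j * avg_F N j\<bar> \<le> t" and large: "nat \<lceil>real (card K) / t\<rceil> \<le> box_size N"
      by blast
    define s where "s = real (box_size N)"
    have s: "0 < s" using box_size_pos by (simp add: s_def)
    have "real (card K) / t \<le> s" using large by (simp add: s_def nat_ceiling_le_eq)
    then have card_K: "real (card K) \<le> t * s" using t by (simp add: field_simps)
    have card_P: "(R - t) * s \<le> real (card (Ibox N j))"
      using dense s by (simp add: ratio_def s_def[symmetric] field_simps)
    have "(1 - \<delta>) * ((R - 2 * t) * s) \<le> (1 - \<delta>) * (real (card (Ibox N j)) - real (card K))"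
      using card_K card_P \<open>\<delta> \<le> 1\<close> by (intro mult_left_mono) (simp_all add: algebra_simps)
    also have "\<dots> \<le> (1 - \<delta>) * real (card (Ibox N j - K))"
    proof (rule mult_left_mono)
      have "card (Ibox N j) \<le> card (Ibox N j - K) + card K"
        using finite_Ibox[OF j] fin
        by (metis add.commute diff_card_le_card_Diff le_diff_conv)
      then show "real (card (Ibox N j)) - real (card K) \<le> real (card (Ibox N j - K))" by linarith
    qed (use \<open>\<delta> \<le> 1\<close> in simp)
    also have "\<dots> = (\<Sum>i\<in>Ibox N j - K. 1 - \<delta>)" by simp
    also have "\<dots> \<le> sum F.leverage (Ibox N j - K)"
      by (intro sum_mono) (auto simp: K_def I_box_def)
    also have "\<dots> \<le> sum F.leverage (Ibox N j)"
      by (intro sum_mono2 finite_Ibox j F.leverage_nonneg) auto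
    also have "\<dots> = ratio N j * avg_F N j * s"
      using s by (simp add: ratio_mult_avg_F[OF j] s_def)
    also have "\<dots> \<le> (X + 2 * t) * s"
      using avg s by (intro mult_right_mono) linarith+
    finally have "(1 - \<delta>) * (R - 2 * t) \<le> X + 2 * t" using s by (simp add: mult.assoc[symmetric])
    moreover have "R - 2 * t = X + 3 * t" by (simp add: t_def field_simps)
    ultimately show False using \<delta>_gap t by (simp add: algebra_simps)
  qed
  then show ?thesis
    using \<delta> by (intro F.remove_infinite_subset[of K \<delta>]) (auto simp: K_def)
qed

lemma avg_E_riesz:
  assumes "riesz_basis smul ip (carrier G) e" "j \<in> carrier G"
  shows "avg_E N j = 1"
proof -
  have "sum E.leverage (Sbox N j) = (\<Sum>k\<in>Sbox N j. 1)"
    using E.riesz_basis_leverage[OF assms(1)] box_subset_carrier[of N j] by (intro sum.cong) (auto simp: subset_iff)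
  then show ?thesis
    using assms(2) box_size_pos[of N] by (simp add: avg_E_eq card_box)
qed

lemma avg_F_riesz:
  assumes "riesz_basis smul ip I f" "j \<in> carrier G" "Ibox N j \<noteq> {}"
  shows "avg_F N j = 1"
proof -
  have "sum F.leverage (Ibox N j) = (\<Sum>k\<in>Ibox N j. 1)"
    using F.riesz_basis_leverage[OF assms(1)] by (intro sum.cong) (auto simp: I_box_def)
  then show ?thesis
    using assms finite_Ibox[of j N] by (simp add: avg_F_eq)
qed

lemma measures_E_riesz:
  assumes "riesz_basis smul ip (carrier G) e"
  shows "lower_measure_E smul ip \<alpha>s ns e = 1" "upper_measure_E smul ip \<alpha>s ns e = 1"
    "free_ultrafilter p \<Longrightarrow> (\<And>N. c N \<in> carrier G) \<Longrightarrow> measure_E smul ip \<alpha>s ns e p c = 1"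
proof -
  show "lower_measure_E smul ip \<alpha>s ns e = 1" "upper_measure_E smul ip \<alpha>s ns e = 1"
    using carrier_nonempty
    by (simp_all add: lower_measure_E_def upper_measure_E_def avg_E_riesz[OF assms] Liminf_const
        Limsup_const one_ereal_def cong: INF_cong SUP_cong)
  show "measure_E smul ip \<alpha>s ns e p c = 1" if "free_ultrafilter p" "\<And>N. c N \<in> carrier G"
    unfolding measure_E_def using that
    by (intro tendsto_Lim) (simp_all add: avg_E_riesz[OF assms] free_ultrafilter_def one_ereal_def)
qed

text \<open>
  With both measures of \<open>\<E>\<close> equal to 1, the extremal inequalities become equalities; and a
  leverage is at most 1, so the lower density is at least 1.
\<close>

lemma riesz_reference:
  assumes E: "riesz_basis smul ip (carrier G) e"
  obtains Lr Ur Ly Uy where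
    "lower_density \<alpha>s ns I a = ereal Lr" "upper_density \<alpha>s ns I a = ereal Ur"
    "lower_measure_F smul ip \<alpha>s ns I a f = ereal Ly" "upper_measure_F smul ip \<alpha>s ns I a f = ereal Uy"
    "Ur * Ly = 1" "Lr * Uy = 1" "1 \<le> Lr"
proof -
  obtain Lx Ux Lr Ur Ly Uy where vals:
      "lower_measure_E smul ip \<alpha>s ns e = ereal Lx" "upper_measure_E smul ip \<alpha>s ns e = ereal Ux"
      "lower_density \<alpha>s ns I a = ereal Lr" "upper_density \<alpha>s ns I a = ereal Ur"
      "lower_measure_F smul ip \<alpha>s ns I a f = ereal Ly" "upper_measure_F smul ip \<alpha>s ns I a f = ereal Uy"
    and ineqs: "Lx \<le> Ur * Ly" "Ur * Ly \<le> Ux" "Lx \<le> Lr * Uy" "Lr * Uy \<le> Ux"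
      "0 \<le> Lr" "Uy \<le> 1" "0 \<le> Ux"
    by (rule extremal_measures)
  have "Lx = 1" "Ux = 1" using vals(1,2) measures_E_riesz(1,2)[OF E] by simp_all
  with ineqs have one: "Ur * Ly = 1" "Lr * Uy = 1" by simp_all
  have "1 \<le> Lr" using one(2) mult_left_mono[OF ineqs(6,5)] by simp
  with vals(3-6) one that show ?thesis by blast
qed

text \<open>
  Over an empty box the average of \<open>\<F>\<close> is \<open>0\<close> by convention, so empty boxes have to be excluded before
  the averages of a Riesz basis \<open>\<F>\<close> can be said to equal 1.
\<close>

lemma nonempty_boxes_if_riesz_reference:
  assumes "riesz_basis smul ip (carrier G) e"
  shows "\<forall>\<^sub>F N in sequentially. \<forall>j\<in>carrier G. Ibox N j \<noteq> {}"
proof -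
  have "\<forall>\<^sub>F N in sequentially. \<forall>j\<in>carrier G. \<bar>avg_E N j - ratio N j * avg_F N j\<bar> \<le> 1 / 2"
    by (rule averages_close) simp
  then show ?thesis
  proof (rule eventually_mono, intro ballI notI)
    fix N j
    assume "\<forall>j\<in>carrier G. \<bar>avg_E N j - ratio N j * avg_F N j\<bar> \<le> 1 / 2" "j \<in> carrier G" "Ibox N j = {}"
    then have "\<bar>avg_E N j - 0\<bar> \<le> 1 / 2" by (force simp: ratio_def)
    then show False using avg_E_riesz[OF assms \<open>j \<in> carrier G\<close>] by simp
  qed
qed

lemma measures_F_riesz:
  assumes E: "riesz_basis smul ip (carrier G) e" and F: "riesz_basis smul ip I f"
  shows "lower_measure_F smul ip \<alpha>s ns I a f = 1" "upper_measure_F smul ip \<alpha>s ns I a f = 1"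
    "free_ultrafilter p \<Longrightarrow> (\<And>N. c N \<in> carrier G) \<Longrightarrow> measure_F smul ip \<alpha>s ns I a f p c = 1"
proof -
  have ev: "\<forall>\<^sub>F N in sequentially. \<forall>j\<in>carrier G. avg_F N j = 1"
    using nonempty_boxes_if_riesz_reference[OF E] by (rule eventually_mono) (simp add: avg_F_riesz[OF F])
  have "\<forall>\<^sub>F N in sequentially. (INF j\<in>carrier G. ereal (avg_F N j)) = 1"
    using ev by (rule eventually_mono) (simp add: carrier_nonempty one_ereal_def cong: INF_cong)
  from Liminf_eq[OF this] show "lower_measure_F smul ip \<alpha>s ns I a f = 1"
    by (simp add: lower_measure_F_def Liminf_const)
  have "\<forall>\<^sub>F N in sequentially. (SUP j\<in>carrier G. ereal (avg_F N j)) = 1"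
    using ev by (rule eventually_mono) (simp add: carrier_nonempty one_ereal_def cong: SUP_cong)
  from Limsup_eq[OF this] show "upper_measure_F smul ip \<alpha>s ns I a f = 1"
    by (simp add: upper_measure_F_def Limsup_const)
  show "measure_F smul ip \<alpha>s ns I a f p c = 1" if p: "free_ultrafilter p" and c: "\<And>N. c N \<in> carrier G"
    unfolding measure_F_def
  proof (rule tendsto_Lim)
    show "p \<noteq> bot" using p by (simp add: free_ultrafilter_def)
    show "((\<lambda>N. ereal (avg_F N (c N))) \<longlongrightarrow> 1) p"
      using eventually_free_ultrafilter_if_sequentially[OF p ev]
      by (intro tendsto_eventually) (auto elim!: eventually_mono simp: c one_ereal_def)
  qed
qed

end

theorem theorem3p5:
  fixes smul :: "'k::real_or_complex \<Rightarrow> 'h::{banach, second_countable_topology} \<Rightarrow> 'h"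
    and ip :: "'h \<Rightarrow> 'h \<Rightarrow> 'k"
    and \<alpha>s :: "real list" and ns :: "nat list"
    and I :: "'i set" and f :: "'i \<Rightarrow> 'h" and a :: "'i \<Rightarrow> refelem"
    and e :: "refelem \<Rightarrow> 'h"
  assumes H: "hilbert_space smul ip"
    and finite_factors: "\<forall>n\<in>set ns. n > 0"
    and infinite_G: "infinite (carrier (refgroup \<alpha>s ns))"
    and I: "countable I"
    and F: "is_frame ip I f"
    and E: "is_frame ip (carrier (refgroup \<alpha>s ns)) e"
    and a: "a \<in> I \<rightarrow> carrier (refgroup \<alpha>s ns)"
    and D: "upper_density \<alpha>s ns I a < \<infinity>"
    and column: "l2_column_decay ip \<alpha>s ns I f a e"
    and row: "l2_row_decay ip \<alpha>s ns I f a e"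
  shows
    \<comment> \<open>(a)\<close>
    "(\<forall>p c. free_ultrafilter p \<and> (\<forall>N. c N \<in> carrier (refgroup \<alpha>s ns)) \<longrightarrow>
        measure_E smul ip \<alpha>s ns e p c
          = density_along \<alpha>s ns I a p c * measure_F smul ip \<alpha>s ns I a f p c) \<and>
     (lower_measure_E smul ip \<alpha>s ns e
        \<le> upper_density \<alpha>s ns I a * lower_measure_F smul ip \<alpha>s ns I a f \<and>
      upper_density \<alpha>s ns I a * lower_measure_F smul ip \<alpha>s ns I a f
        \<le> upper_measure_E smul ip \<alpha>s ns e \<and>
      lower_measure_E smul ip \<alpha>s ns e
        \<le> lower_density \<alpha>s ns I a * upper_measure_F smul ip \<alpha>s ns I a f \<and>
      lower_density \<alpha>s ns I a * upper_measure_F smul ip \<alpha>s ns I a f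
        \<le> upper_measure_E smul ip \<alpha>s ns e) \<and>
     \<comment> \<open>(b)\<close>
     (upper_density \<alpha>s ns I a > upper_measure_E smul ip \<alpha>s ns e \<longrightarrow>
        (\<exists>J\<subseteq>I. infinite J \<and> is_frame ip (I - J) f)) \<and>
     (riesz_basis smul ip (carrier (refgroup \<alpha>s ns)) e \<longrightarrow>
        \<comment> \<open>(c)\<close>
        (\<forall>p c. free_ultrafilter p \<and> (\<forall>N. c N \<in> carrier (refgroup \<alpha>s ns)) \<longrightarrow>
           measure_F smul ip \<alpha>s ns I a f p c = 1 / density_along \<alpha>s ns I a p c \<and>
           lower_measure_F smul ip \<alpha>s ns I a f = 1 / upper_density \<alpha>s ns I a \<and>
           upper_measure_F smul ip \<alpha>s ns I a f = 1 / lower_density \<alpha>s ns I a) \<and>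
        \<comment> \<open>(d)\<close>
        lower_density \<alpha>s ns I a \<ge> 1 \<and>
        \<comment> \<open>(e)\<close>
        (upper_density \<alpha>s ns I a > 1 \<longrightarrow>
           (\<exists>J\<subseteq>I. infinite J \<and> is_frame ip (I - J) f)) \<and>
        \<comment> \<open>(f)\<close>
        (riesz_basis smul ip I f \<longrightarrow>
           (\<forall>p c. free_ultrafilter p \<and> (\<forall>N. c N \<in> carrier (refgroup \<alpha>s ns)) \<longrightarrow>
              lower_density \<alpha>s ns I a = 1 \<and> density_along \<alpha>s ns I a p c = 1 \<and>
              upper_density \<alpha>s ns I a = 1 \<and>
              lower_measure_F smul ip \<alpha>s ns I a f = 1 \<and>
              measure_F smul ip \<alpha>s ns I a f p c = 1 \<and>
              upper_measure_F smul ip \<alpha>s ns I a f = 1)))"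
proof -
  interpret hilbert_space smul ip by (rule H)
  obtain A B where "framed smul ip I f A B" using framed_if_is_frame[OF F] .
  moreover obtain A' B' where "framed smul ip (carrier (refgroup \<alpha>s ns)) e A' B'"
    using framed_if_is_frame[OF E] .
  ultimately interpret localized_frames smul ip I f A B \<alpha>s ns e A' B' a
    using finite_factors infinite_G a D column row
    by (simp add: localized_frames_def localized_frames_axioms_def frame_pair_def reference_group_def)
  obtain Lx Ux Lr Ur Ly Uy where vals:
      "lower_measure_E smul ip \<alpha>s ns e = ereal Lx" "upper_measure_E smul ip \<alpha>s ns e = ereal Ux"
      "lower_density \<alpha>s ns I a = ereal Lr" "upper_density \<alpha>s ns I a = ereal Ur"
      "lower_measure_F smul ip \<alpha>s ns I a f = ereal Ly" "upper_measure_F smul ip \<alpha>s ns I a f = ereal Uy"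
    and ineqs: "Lx \<le> Ur * Ly" "Ur * Ly \<le> Ux" "Lx \<le> Lr * Uy" "Lr * Uy \<le> Ux"
    by (rule extremal_measures)
  have product: "measure_E smul ip \<alpha>s ns e p c
      = density_along \<alpha>s ns I a p c * measure_F smul ip \<alpha>s ns I a f p c"
    if "free_ultrafilter p" "\<forall>N. c N \<in> carrier (refgroup \<alpha>s ns)" for p c
    by (rule limits_along_ultrafilter[OF that(1), of c]) (use that(2) in simp_all)
  have b: "\<exists>J\<subseteq>I. infinite J \<and> is_frame ip (I - J) f"
    if "upper_density \<alpha>s ns I a > upper_measure_E smul ip \<alpha>s ns e"
    by (rule removable_if_density_exceeds_measure[OF that])
  have c: "measure_F smul ip \<alpha>s ns I a f p c = 1 / density_along \<alpha>s ns I a p c"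
      "lower_measure_F smul ip \<alpha>s ns I a f = 1 / upper_density \<alpha>s ns I a"
      "upper_measure_F smul ip \<alpha>s ns I a f = 1 / lower_density \<alpha>s ns I a"
    if riesz: "riesz_basis smul ip (carrier (refgroup \<alpha>s ns)) e" and p: "free_ultrafilter p"
      and c: "\<forall>N. c N \<in> carrier (refgroup \<alpha>s ns)" for p c
  proof -
    obtain X R Y where XRY: "measure_E smul ip \<alpha>s ns e p c = ereal X"
        "density_along \<alpha>s ns I a p c = ereal R" "measure_F smul ip \<alpha>s ns I a f p c = ereal Y" "X = R * Y"
      by (rule limits_along_ultrafilter[OF p, of c]) (use c in blast)+
    have inverse: "ereal v = 1 / ereal u" if "u * v = 1" for u v :: real
      using that by (cases "u = 0") (auto simp: one_ereal_def field_simps)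
    have "R * Y = 1" using XRY measures_E_riesz(3)[OF riesz p, of c] c by simp
    then show "measure_F smul ip \<alpha>s ns I a f p c = 1 / density_along \<alpha>s ns I a p c"
      unfolding XRY by (rule inverse)
    obtain Lr Ur Ly Uy where vals:
        "lower_density \<alpha>s ns I a = ereal Lr" "upper_density \<alpha>s ns I a = ereal Ur"
        "lower_measure_F smul ip \<alpha>s ns I a f = ereal Ly" "upper_measure_F smul ip \<alpha>s ns I a f = ereal Uy"
      and one: "Ur * Ly = 1" "Lr * Uy = 1" "1 \<le> Lr"
      by (rule riesz_reference[OF riesz])
    show "lower_measure_F smul ip \<alpha>s ns I a f = 1 / upper_density \<alpha>s ns I a"
      "upper_measure_F smul ip \<alpha>s ns I a f = 1 / lower_density \<alpha>s ns I a"
      unfolding vals by (rule inverse[OF one(1)] inverse[OF one(2)])+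
  qed
  have d: "lower_density \<alpha>s ns I a \<ge> 1"
    if riesz: "riesz_basis smul ip (carrier (refgroup \<alpha>s ns)) e"
    by (rule riesz_reference[OF riesz]) (simp add: one_ereal_def)
  have e: "\<exists>J\<subseteq>I. infinite J \<and> is_frame ip (I - J) f"
    if "riesz_basis smul ip (carrier (refgroup \<alpha>s ns)) e" "upper_density \<alpha>s ns I a > 1"
    using b that measures_E_riesz(2) by simp
  have f: "lower_density \<alpha>s ns I a = 1" "density_along \<alpha>s ns I a p c = 1"
      "upper_density \<alpha>s ns I a = 1" "lower_measure_F smul ip \<alpha>s ns I a f = 1"
      "measure_F smul ip \<alpha>s ns I a f p c = 1" "upper_measure_F smul ip \<alpha>s ns I a f = 1"
    if riesz: "riesz_basis smul ip (carrier (refgroup \<alpha>s ns)) e" "riesz_basis smul ip I f"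
      and p: "free_ultrafilter p" and c: "\<forall>N. c N \<in> carrier (refgroup \<alpha>s ns)" for p c
  proof -
    have F_one: "lower_measure_F smul ip \<alpha>s ns I a f = 1" "upper_measure_F smul ip \<alpha>s ns I a f = 1"
        "measure_F smul ip \<alpha>s ns I a f p c = 1"
      using measures_F_riesz[OF riesz] p c by simp_all
    have "measure_E smul ip \<alpha>s ns e p c = 1"
      using measures_E_riesz(3)[OF riesz(1) p] c by simp
    with product[OF p c] F_one show "density_along \<alpha>s ns I a p c = 1" by simp
    obtain Lr Ur Ly Uy where
        "lower_density \<alpha>s ns I a = ereal Lr" "upper_density \<alpha>s ns I a = ereal Ur"
        "lower_measure_F smul ip \<alpha>s ns I a f = ereal Ly" "upper_measure_F smul ip \<alpha>s ns I a f = ereal Uy"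
        "Ur * Ly = 1" "Lr * Uy = 1" "1 \<le> Lr"
      by (rule riesz_reference[OF riesz(1)])
    then show "lower_density \<alpha>s ns I a = 1" "upper_density \<alpha>s ns I a = 1"
      using F_one by (simp_all add: one_ereal_def)
    show "lower_measure_F smul ip \<alpha>s ns I a f = 1" "upper_measure_F smul ip \<alpha>s ns I a f = 1"
      "measure_F smul ip \<alpha>s ns I a f p c = 1" by (rule F_one)+
  qed
  have inequalities: "lower_measure_E smul ip \<alpha>s ns e
        \<le> upper_density \<alpha>s ns I a * lower_measure_F smul ip \<alpha>s ns I a f"
      "upper_density \<alpha>s ns I a * lower_measure_F smul ip \<alpha>s ns I a f
        \<le> upper_measure_E smul ip \<alpha>s ns e"
      "lower_measure_E smul ip \<alpha>s ns e
        \<le> lower_density \<alpha>s ns I a * upper_measure_F smul ip \<alpha>s ns I a f"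
      "lower_density \<alpha>s ns I a * upper_measure_F smul ip \<alpha>s ns I a f
        \<le> upper_measure_E smul ip \<alpha>s ns e"
    using ineqs by (simp_all add: vals)
  show ?thesis
    by (intro conjI impI allI inequalities; (elim conjE)?; (rule product b c d e f; assumption))
qed

end
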